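(* Let $K$ be a PAC field of characteristic $\neq 2$, and let $n\geq 1$ be an integer. A non-degenerate quadratic form of dimension $n$ over $K$ is isomorphic (over $K$) to a scaled trace form over $K$ if and only if $K$ has a separable field extension of degree $n$.
   Context: A field $K$ is PAC (pseudo algebraically closed) if every (absolutely irreducible) variety defined over $K$ has a $K$-rational point; equivalently, every absolutely irreducible polynomial $f(X,Y)$ in two variables with coefficients in $K$ has infinitely many roots $(x,y)\in K^2$. A scaled trace form over $K$ is a quadratic form of the shape $x\mapsto \mathrm{Tr}_{F/K}(\alpha x^2)$, $x\in F$, where $F/K$ is a finite separable field extension and $\alpha\in F$ is nonzero; it is a quadratic form over $K$ of dimension $[F:K]$. *)

theory Defs
  imports "HOL-Algebra.Algebraic_Closure_Type"
begin

section \<open>PAC fields\<close>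

text \<open>
  A polynomial in \<open>K[X, Y]\<close> is an element of \<open>K[X][Y]\<close>, i.e. of type \<^typ>\<open>'a poly poly\<close>. The
  qualified names are needed because HOL-Algebra has its own \<open>irreducible\<close>.
\<close>

definition absolutely_irreducible :: "'a::field poly poly \<Rightarrow> bool" where
  "absolutely_irreducible f \<longleftrightarrow> Factorial_Ring.irreducible (map_poly (map_poly to_ac) f)"

definition PAC :: "'a::field itself \<Rightarrow> bool" where
  "PAC _ \<longleftrightarrow> (\<forall>f :: 'a poly poly. absolutely_irreducible f \<longrightarrow>
     infinite {(x, y). poly (poly f [:y:]) x = 0})"


section \<open>Finite separable extensions\<close>

text \<open>
  Every finite extension of \<open>K\<close> embeds over \<open>K\<close> into the algebraic closure of \<open>K\<close>, so finite
  extensions of \<open>K\<close> are represented by the intermediate fields of the closure.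
\<close>

definition ac_scale :: "'a::field \<Rightarrow> 'a alg_closure \<Rightarrow> 'a alg_closure" where
  "ac_scale c x = to_ac c * x"

interpretation ac: vector_space "ac_scale :: 'a::field \<Rightarrow> _"
  by unfold_locales (simp_all add: ac_scale_def algebra_simps)

definition basis_of :: "'a::field alg_closure set \<Rightarrow> 'a alg_closure set \<Rightarrow> bool" where
  "basis_of F B \<longleftrightarrow> ac.independent B \<and> ac.span B = F"

definition separable_poly :: "'a::field poly \<Rightarrow> bool" where
  "separable_poly p \<longleftrightarrow> rsquarefree (map_poly to_ac p)"

text \<open>
  An irreducible polynomial vanishing at \<open>x\<close> is, up to a constant factor, the minimal polynomial
  of \<open>x\<close> over \<open>K\<close>.
\<close>

definition separable_element :: "'a::field alg_closure \<Rightarrow> bool" where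
  "separable_element x \<longleftrightarrow> (\<exists>p :: 'a poly.
     Factorial_Ring.irreducible p \<and> poly (map_poly to_ac p) x = 0 \<and> separable_poly p)"

definition finite_separable_extension :: "'a::field alg_closure set \<Rightarrow> bool" where
  "finite_separable_extension F \<longleftrightarrow>
     subfield F ring_of_type_algebra \<and> range to_ac \<subseteq> F \<and>
     (\<exists>B. finite B \<and> basis_of F B) \<and> (\<forall>x\<in>F. separable_element x)"

abbreviation ext_degree :: "'a::field alg_closure set \<Rightarrow> nat" where
  "ext_degree F \<equiv> ac.dim F"


section \<open>Quadratic forms and scaled trace forms\<close>

text \<open>
  The trace of multiplication by \<open>x\<close> on the \<open>K\<close>-vector space \<open>F\<close>, computed as the sum of the
  diagonal entries of its matrix in some basis; it does not depend on the basis.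
\<close>

definition field_trace :: "'a::field alg_closure set \<Rightarrow> 'a alg_closure \<Rightarrow> 'a" where
  "field_trace F x =
     (let B = (SOME B. basis_of F B) in \<Sum>b\<in>B. ac.representation B (x * b) b)"

definition scaled_trace_form ::
    "'a::field alg_closure set \<Rightarrow> 'a alg_closure \<Rightarrow> 'a alg_closure \<Rightarrow> 'a" where
  "scaled_trace_form F \<alpha> x = field_trace F (\<alpha> * x\<^sup>2)"

definition polar :: "('v::ab_group_add \<Rightarrow> 'a::field) \<Rightarrow> 'v \<Rightarrow> 'v \<Rightarrow> 'a" where
  "polar q u v = q (u + v) - q u - q v"

definition quadratic_form ::
    "('a::field \<Rightarrow> 'v::ab_group_add \<Rightarrow> 'v) \<Rightarrow> ('v \<Rightarrow> 'a) \<Rightarrow> bool" where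
  "quadratic_form scale q \<longleftrightarrow> vector_space scale \<and>
     (\<forall>c v. q (scale c v) = c\<^sup>2 * q v) \<and>
     (\<forall>u. Vector_Spaces.linear scale (*) (polar q u)) \<and>
     (\<forall>v. Vector_Spaces.linear scale (*) (\<lambda>u. polar q u v))"

text \<open>Non-degeneracy in this form is the standard notion only in characteristic other than 2.\<close>

definition nondegenerate :: "('v::ab_group_add \<Rightarrow> 'a::field) \<Rightarrow> bool" where
  "nondegenerate q \<longleftrightarrow> (\<forall>u. (\<forall>v. polar q u v = 0) \<longrightarrow> u = 0)"

definition isomorphic_to_scaled_trace_form ::
    "('a::field \<Rightarrow> 'v::ab_group_add \<Rightarrow> 'v) \<Rightarrow> ('v \<Rightarrow> 'a) \<Rightarrow> bool" where
  "isomorphic_to_scaled_trace_form scale q \<longleftrightarrow>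
     (\<exists>F \<alpha> \<phi>. finite_separable_extension F \<and> \<alpha> \<in> F \<and> \<alpha> \<noteq> 0 \<and>
        Vector_Spaces.linear scale ac_scale \<phi> \<and> bij_betw \<phi> UNIV F \<and>
        (\<forall>v. q v = scaled_trace_form F \<alpha> (\<phi> v)))"

end

theory Submission
  imports Defs "Jordan_Normal_Form.Char_Poly"
begin

text \<open>
  If \<open>p\<close> has a simple root in the algebraic closure, then \<open>c Y\<^sup>2 - p(X)\<close> is absolutely irreducible, so
  over a PAC field the curve \<open>c Y\<^sup>2 = p(X)\<close> has infinitely many points. With \<open>p = 1 - a X\<^sup>2\<close> this makes
  all binary forms represent \<open>1\<close>, so every non-degenerate form of dimension \<open>n\<close> is \<open>\<langle>1, \<dots>, 1, d\<rangle>\<close>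
  and is determined by its discriminant. Given a separable extension \<open>F = K(\<theta>)\<close> of degree \<open>n\<close>, the
  form \<open>Tr(\<alpha> x\<^sup>2)\<close> has the discriminant of \<open>Tr(x\<^sup>2)\<close> times the norm of \<open>\<alpha>\<close>. Taking for \<open>p\<close> the minimal
  polynomial of \<open>\<theta>\<close>, whose values are the norms \<open>N(t - \<theta>)\<close>, the curve shows that every class modulo
  squares is a norm. So \<open>F\<close> itself carries a scaled trace form with any prescribed discriminant.
\<close>

section \<open>Orthogonal bases of symmetric bilinear forms\<close>

text \<open>The form need only be bilinear, symmetric and non-degenerate on the subspace
  \<open>W\<close>, so that one locale covers both a form on a whole type and a trace form on a
  field \<open>F\<close> inside the closure.\<close>

locale sym_form = vector_space scale
  for scale :: "'a::field \<Rightarrow> 'v::ab_group_add \<Rightarrow> 'v" +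
  fixes W :: "'v set" and C :: "'v set" and n :: nat and \<beta> :: "'v \<Rightarrow> 'v \<Rightarrow> 'a"
  assumes basis: "finite C" "independent C" "span C = W" "card C = n"
    and add_left: "\<And>u u' v. u \<in> W \<Longrightarrow> u' \<in> W \<Longrightarrow> v \<in> W \<Longrightarrow> \<beta> (u + u') v = \<beta> u v + \<beta> u' v"
    and scale_left: "\<And>c u v. u \<in> W \<Longrightarrow> v \<in> W \<Longrightarrow> \<beta> (scale c u) v = c * \<beta> u v"
    and sym: "\<And>u v. u \<in> W \<Longrightarrow> v \<in> W \<Longrightarrow> \<beta> u v = \<beta> v u"
    and nondeg: "\<And>u. u \<in> W \<Longrightarrow> (\<And>v. v \<in> W \<Longrightarrow> \<beta> u v = 0) \<Longrightarrow> u = 0"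
    and two: "(2::'a) \<noteq> 0"
begin

lemma subspace_W: "subspace W"
  using basis(3) subspace_span by blast

lemmas W_closed [simp] = subspace_add[OF subspace_W] subspace_scale[OF subspace_W]
  subspace_0[OF subspace_W] subspace_diff[OF subspace_W]

lemma sum_closed [simp]: "(\<And>i. i \<in> I \<Longrightarrow> u i \<in> W) \<Longrightarrow> (\<Sum>i\<in>I. u i) \<in> W"
  by (rule subspace_sum[OF subspace_W])

lemma zero_left [simp]: "v \<in> W \<Longrightarrow> \<beta> 0 v = 0"
  using scale_left[of 0 v 0] by simp

lemma add_right: "u \<in> W \<Longrightarrow> v \<in> W \<Longrightarrow> v' \<in> W \<Longrightarrow> \<beta> u (v + v') = \<beta> u v + \<beta> u v'"
  using add_left[of v v' u] sym[of u] by simp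

lemma scale_right: "u \<in> W \<Longrightarrow> v \<in> W \<Longrightarrow> \<beta> u (scale c v) = c * \<beta> u v"
  using scale_left[of v u c] sym[of u] by simp

lemma diff_left: "u \<in> W \<Longrightarrow> u' \<in> W \<Longrightarrow> v \<in> W \<Longrightarrow> \<beta> (u - u') v = \<beta> u v - \<beta> u' v"
  using add_left[of "u - u'" u' v] by simp

lemma diff_right: "u \<in> W \<Longrightarrow> v \<in> W \<Longrightarrow> v' \<in> W \<Longrightarrow> \<beta> u (v - v') = \<beta> u v - \<beta> u v'"
  using diff_left[of v v' u] sym[of u] by simp

lemma sum_left:
  assumes "\<And>i. i \<in> I \<Longrightarrow> u i \<in> W" "v \<in> W"
  shows "\<beta> (\<Sum>i\<in>I. u i) v = (\<Sum>i\<in>I. \<beta> (u i) v)"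
  using assms by (induction I rule: infinite_finite_induct) (simp_all add: add_left)

lemma sum_scale_left:
  assumes "\<And>i. i \<in> I \<Longrightarrow> u i \<in> W" "v \<in> W"
  shows "\<beta> (\<Sum>i\<in>I. scale (c i) (u i)) v = (\<Sum>i\<in>I. c i * \<beta> (u i) v)"
  using assms by (simp add: sum_left scale_left)

text \<open>The vectors orthogonal to \<open>a\<close> form a subspace, so an \<open>a\<close> in
  the span of the other elements would be orthogonal to itself.\<close>

lemma orthogonal_independent:
  assumes S: "S \<subseteq> W" "\<And>u v. u \<in> S \<Longrightarrow> v \<in> S \<Longrightarrow> u \<noteq> v \<Longrightarrow> \<beta> u v = 0" "\<And>u. u \<in> S \<Longrightarrow> \<beta> u u \<noteq> 0"
  shows "independent S"
proof
  assume "dependent S"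
  then obtain a where a: "a \<in> S" "a \<in> span (S - {a})"
    unfolding dependent_def by blast
  have "subspace {x \<in> W. \<beta> a x = 0}"
    using a(1) S(1) by (auto simp: subspace_def add_right scale_right sym[of a 0])
  moreover have "S - {a} \<subseteq> {x \<in> W. \<beta> a x = 0}"
    using S a by auto
  ultimately have "span (S - {a}) \<subseteq> {x \<in> W. \<beta> a x = 0}"
    using span_minimal by blast
  with a S(3) show False by blast
qed

lemma independent_card_span:
  assumes "independent T" "T \<subseteq> W" "card T = n" "finite T"
  shows "span T = W"
proof -
  have "w \<in> span T" if w: "w \<in> W" for w
  proof (rule ccontr)
    assume "w \<notin> span T"
    then have "independent (insert w T)" "w \<notin> T"
      using independent_insertI assms(1) span_base by blast+
    moreover have "insert w T \<subseteq> span C"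
      using w assms basis by simp
    ultimately have "card (insert w T) \<le> card C"
      using independent_span_bound[OF basis(1)] by blast
    with \<open>w \<notin> T\<close> assms basis show False by simp
  qed
  then show ?thesis
    using span_minimal[OF assms(2) subspace_W] by blast
qed

definition orthogonal_basis :: "(nat \<Rightarrow> 'v) \<Rightarrow> bool" where
  "orthogonal_basis e \<longleftrightarrow> (\<forall>i<n. e i \<in> W \<and> \<beta> (e i) (e i) \<noteq> 0) \<and>
     (\<forall>i<n. \<forall>j<n. i \<noteq> j \<longrightarrow> \<beta> (e i) (e j) = 0)"

lemma orthogonal_basisD:
  assumes "orthogonal_basis e" "i < n"
  shows "e i \<in> W" "\<beta> (e i) (e i) \<noteq> 0" "j < n \<Longrightarrow> i \<noteq> j \<Longrightarrow> \<beta> (e i) (e j) = 0"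
  using assms unfolding orthogonal_basis_def by blast+

text \<open>An orthogonal set of non-isotropic vectors of maximal size spans \<open>W\<close>: by
  maximality its orthogonal complement has only isotropic vectors, so by polarization the form
  vanishes there, and non-degeneracy makes the complement zero.\<close>

lemma ex_orthogonal_basis: "\<exists>e. orthogonal_basis e"
proof -
  define P where "P S \<longleftrightarrow> finite S \<and> S \<subseteq> W \<and> (\<forall>u\<in>S. \<beta> u u \<noteq> 0) \<and>
    (\<forall>u\<in>S. \<forall>v\<in>S. u \<noteq> v \<longrightarrow> \<beta> u v = 0)" for S
  have bound: "independent S \<and> card S \<le> n" if "P S" for S
  proof -
    have "independent S"
      using that orthogonal_independent[of S] unfolding P_def by blast
    then show ?thesis
      using independent_span_bound[OF basis(1), of S] that basis unfolding P_def by simp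
  qed
  have "P {}" by (simp add: P_def)
  then have "\<exists>S. P S \<and> (\<forall>T. P T \<longrightarrow> card T \<le> card S)"
    using bound by (intro ex_has_greatest_nat[of P "{}" card "Suc n"]) (simp_all add: le_imp_less_Suc)
  then obtain S where S: "P S" and max: "\<And>T. P T \<Longrightarrow> card T \<le> card S"
    by blast
  have SW: "S \<subseteq> W" "finite S" using S by (auto simp: P_def)
  \<comment> \<open>The component of \<open>w\<close> orthogonal to \<open>S\<close>; the aim is
    \<open>pr w = 0\<close>.\<close>
  define pr where "pr w = w - (\<Sum>s\<in>S. scale (\<beta> w s / \<beta> s s) s)" for w
  have pr_W: "pr w \<in> W" if "w \<in> W" for w
    unfolding pr_def using that SW by (auto intro!: W_closed(4) sum_closed)
  have pr_orth: "\<beta> (pr w) s = 0" if "w \<in> W" "s \<in> S" for w s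
  proof -
    have "\<beta> (\<Sum>s\<in>S. scale (\<beta> w s / \<beta> s s) s) s = (\<Sum>t\<in>S. (\<beta> w t / \<beta> t t) * \<beta> t s)"
      using that SW by (intro sum_scale_left) auto
    also have "\<dots> = (\<Sum>t\<in>S. if t = s then \<beta> w s else 0)"
      using S that by (intro sum.cong) (auto simp: P_def)
    also have "\<dots> = \<beta> w s"
      using SW that by simp
    finally show ?thesis
      unfolding pr_def using that SW by (subst diff_left) (auto intro!: sum_closed)
  qed
  have iso: "\<beta> u u = 0" if u: "u \<in> W" "\<And>s. s \<in> S \<Longrightarrow> \<beta> u s = 0" for u
  proof (rule ccontr)
    assume "\<beta> u u \<noteq> 0"
    moreover from this have "u \<notin> S" using u by blast
    moreover have "\<beta> s u = 0" if "s \<in> S" for s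
      using u SW that sym[of s u] by auto
    ultimately have "P (insert u S)"
      using S u unfolding P_def by auto
    from max[OF this] \<open>u \<notin> S\<close> SW show False by simp
  qed
  have "pr w = 0" if w: "w \<in> W" for w
  proof (rule nondeg)
    show "pr w \<in> W" using pr_W w .
    fix x assume x: "x \<in> W"
    \<comment> \<open>Polarization: \<open>pr w\<close>, \<open>pr x\<close> and their sum are all
      isotropic, so twice the product of the first two is 0.\<close>
    have "\<beta> (pr w + pr x) (pr w + pr x) = 0"
      using w x SW(1) by (intro iso) (simp_all add: pr_W pr_orth add_left subset_iff)
    moreover note iso[OF pr_W[OF w] pr_orth[OF w]] iso[OF pr_W[OF x] pr_orth[OF x]]
    ultimately have "2 * \<beta> (pr w) (pr x) = 0"
      using w x sym[of "pr x" "pr w"] by (simp add: add_left add_right pr_W)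
    then have "\<beta> (pr w) (pr x) = 0" using two by simp
    \<comment> \<open>\<open>x\<close> differs from \<open>pr x\<close> by a combination of elements
      of \<open>S\<close>, to which \<open>pr w\<close> is orthogonal.\<close>
    moreover have "\<beta> s (pr w) = 0" if "s \<in> S" for s
      using pr_orth[OF w that] sym[OF pr_W[OF w], of s] that SW by auto
    then have "\<beta> (\<Sum>s\<in>S. scale (\<beta> x s / \<beta> s s) s) (pr w) = 0"
      using SW by (subst sum_scale_left[OF _ pr_W[OF w]]) (auto intro!: sum.neutral)
    then have "\<beta> (pr w) (\<Sum>s\<in>S. scale (\<beta> x s / \<beta> s s) s) = 0"
      using SW by (subst sym[OF pr_W[OF w]]) (auto intro!: sum_closed)
    moreover have "\<beta> (pr w) (pr x + (\<Sum>s\<in>S. scale (\<beta> x s / \<beta> s s) s)) =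
        \<beta> (pr w) (pr x) + \<beta> (pr w) (\<Sum>s\<in>S. scale (\<beta> x s / \<beta> s s) s)"
      using w x SW pr_W by (intro add_right sum_closed) auto
    ultimately show "\<beta> (pr w) x = 0"
      by (simp add: pr_def)
  qed
  then have "w = (\<Sum>s\<in>S. scale (\<beta> w s / \<beta> s s) s)" if "w \<in> W" for w
    using that by (simp add: pr_def)
  moreover have "(\<Sum>s\<in>S. scale (\<beta> w s / \<beta> s s) s) \<in> span S" for w
    by (intro span_sum span_scale span_base)
  ultimately have "W \<subseteq> span S"
    by (metis subsetI)
  then have "span S = W"
    using span_minimal[OF SW(1) subspace_W] by blast
  then have "card S = n"
    using bound[OF S] basis by (metis dim_span_eq_card_independent)
  then obtain e where e: "bij_betw e {0..<n} S"
    using ex_bij_betw_nat_finite[OF SW(2)] by blast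
  have "orthogonal_basis e"
    unfolding orthogonal_basis_def
  proof (intro conjI allI impI)
    fix i j assume "i < n" "j < n" "i \<noteq> j"
    moreover from this have "e i \<in> S" "e j \<in> S" "e i \<noteq> e j"
      using e by (auto simp: bij_betw_def inj_on_def)
    ultimately show "\<beta> (e i) (e j) = 0"
      using S by (auto simp: P_def)
  qed (use e S in \<open>auto simp: P_def bij_betw_def\<close>)
  then show ?thesis by blast
qed

lemma orthogonal_basis_span:
  assumes "orthogonal_basis e"
  shows "span (e ` {..<n}) = W"
proof (rule independent_card_span)
  have "inj_on e {..<n}"
    using orthogonal_basisD[OF assms] by (fastforce intro: inj_onI)
  then show "card (e ` {..<n}) = n"
    by (simp add: card_image)
  show "independent (e ` {..<n})"
    using orthogonal_basisD[OF assms] by (intro orthogonal_independent) auto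
qed (use orthogonal_basisD[OF assms] in auto)

lemma orthogonal_sum:
  assumes "orthogonal_basis e" "j < n"
  shows "\<beta> (\<Sum>i<n. scale (c i) (e i)) (e j) = c j * \<beta> (e j) (e j)"
proof -
  have "\<beta> (\<Sum>i<n. scale (c i) (e i)) (e j) = (\<Sum>i<n. c i * \<beta> (e i) (e j))"
    using orthogonal_basisD[OF assms(1)] assms(2) by (intro sum_scale_left) auto
  also have "\<dots> = (\<Sum>i<n. if i = j then c j * \<beta> (e j) (e j) else 0)"
    using orthogonal_basisD[OF assms(1)] assms(2) by (intro sum.cong) auto
  finally show ?thesis using assms(2) by simp
qed

text \<open>The difference of both sides is orthogonal to every basis vector, hence to
  \<open>W\<close>, hence zero by non-degeneracy.\<close>

lemma orthogonal_expansion: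
  assumes e: "orthogonal_basis e" and u: "u \<in> W"
  shows "(\<Sum>i<n. scale (\<beta> u (e i) / \<beta> (e i) (e i)) (e i)) = u" (is "?s = u")
proof -
  have s: "?s \<in> W" using orthogonal_basisD[OF e] by (intro sum_closed) auto
  have "subspace {x \<in> W. \<beta> (?s - u) x = 0}"
    using s u sym[of "?s - u" 0] by (auto simp: subspace_def add_right scale_right)
  moreover have "e ` {..<n} \<subseteq> {x \<in> W. \<beta> (?s - u) x = 0}"
    using orthogonal_basisD[OF e] u s orthogonal_sum[OF e]
    by (auto simp: diff_left)
  ultimately have "W \<subseteq> {x \<in> W. \<beta> (?s - u) x = 0}"
    using span_minimal orthogonal_basis_span[OF e] by blast
  then have "?s - u = 0"
    using s u by (intro nondeg) auto
  then show ?thesis by simp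
qed

lemma orthogonal_sum_square:
  assumes "orthogonal_basis e"
  shows "\<beta> (\<Sum>i<n. scale (c i) (e i)) (\<Sum>i<n. scale (c i) (e i)) = (\<Sum>i<n. (c i)\<^sup>2 * \<beta> (e i) (e i))"
proof -
  let ?s = "\<Sum>i<n. scale (c i) (e i)"
  have s: "?s \<in> W" using orthogonal_basisD[OF assms] by (intro sum_closed) auto
  have "\<beta> ?s ?s = (\<Sum>i<n. c i * \<beta> (e i) ?s)"
    using s orthogonal_basisD[OF assms] by (intro sum_scale_left) auto
  also have "\<dots> = (\<Sum>i<n. (c i)\<^sup>2 * \<beta> (e i) (e i))"
    using s orthogonal_basisD[OF assms] orthogonal_sum[OF assms] sym[of _ ?s]
    by (intro sum.cong) (auto simp: power2_eq_square)
  finally show ?thesis .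
qed

text \<open>In the plane of two neighbouring basis vectors with values \<open>a\<close> and
  \<open>b\<close>, \<open>univ\<close> supplies a vector of value 1, and a vector orthogonal to it
  takes the value \<open>a * b\<close>. Repeating this along the basis collects the discriminant in
  the last value.\<close>

lemma ex_almost_orthonormal_basis:
  assumes univ: "\<And>a b :: 'a. a \<noteq> 0 \<Longrightarrow> b \<noteq> 0 \<Longrightarrow> \<exists>x y. a * x\<^sup>2 + b * y\<^sup>2 = 1"
  shows "\<exists>e. orthogonal_basis e \<and> (\<forall>i. Suc i < n \<longrightarrow> \<beta> (e i) (e i) = 1)"
proof -
  have "\<exists>e. orthogonal_basis e \<and> (\<forall>i<k. Suc i < n \<longrightarrow> \<beta> (e i) (e i) = 1)" for k
  proof (induction k)
    case 0
    then show ?case using ex_orthogonal_basis by simp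
  next
    case (Suc k)
    then obtain e where e: "orthogonal_basis e" and
      e1: "\<And>i. i < k \<Longrightarrow> Suc i < n \<Longrightarrow> \<beta> (e i) (e i) = 1" by blast
    show ?case
    proof (cases "Suc k < n")
      case False
      then have "\<forall>i<Suc k. Suc i < n \<longrightarrow> \<beta> (e i) (e i) = 1"
        using e1 by (auto simp: less_Suc_eq)
      then show ?thesis using e by blast
    next
      case True
      note eD = orthogonal_basisD[OF e]
      define u v where "u = e k" and "v = e (Suc k)"
      define a b where "a = \<beta> u u" and "b = \<beta> v v"
      have uv: "u \<in> W" "v \<in> W" "\<beta> u v = 0" "\<beta> v u = 0" and ab: "a \<noteq> 0" "b \<noteq> 0"
        using True eD(1,2)[of k] eD(1,2)[of "Suc k"] eD(3)[of k "Suc k"] eD(3)[of "Suc k" k]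
        by (auto simp: u_def v_def a_def b_def)
      obtain x y where xy: "a * x\<^sup>2 + b * y\<^sup>2 = 1"
        using univ[OF ab] by blast
      \<comment> \<open>\<open>v'\<close> is orthogonal to \<open>u'\<close> in the plane and scaled
        so that its value is a b (a x^2 + b y^2) = a b.\<close>
      define u' v' where "u' = scale x u + scale y v" and "v' = scale (- b * y) u + scale (a * x) v"
      have W': "u' \<in> W" "v' \<in> W"
        using uv by (simp_all add: u'_def v'_def)
      have "\<beta> u' u' = a * x\<^sup>2 + b * y\<^sup>2"
        using uv by (simp add: u'_def add_left add_right scale_left scale_right a_def b_def power2_eq_square)
      then have uu: "\<beta> u' u' = 1" using xy by simp
      have uv': "\<beta> u' v' = 0"
        using uv by (simp add: u'_def v'_def add_left add_right diff_right scale_left scale_right a_def b_def)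
      have "\<beta> v' v' = a * b * (a * x\<^sup>2 + b * y\<^sup>2)"
        using uv by (simp add: v'_def add_left add_right diff_left diff_right scale_left scale_right a_def b_def power2_eq_square distrib_left mult_ac)
      then have vv: "\<beta> v' v' = a * b" using xy by simp
      have orth: "\<beta> (e i) u' = 0 \<and> \<beta> (e i) v' = 0" if "i < n" "i \<noteq> k" "i \<noteq> Suc k" for i
        using that True eD(1)[of i] eD(3)[of i k] eD(3)[of i "Suc k"] uv
        by (simp add: u'_def v'_def u_def v_def add_right diff_right scale_right)
      define e' where "e' = e(k := u', Suc k := v')"
      have "orthogonal_basis e'"
        unfolding orthogonal_basis_def
      proof (intro conjI allI impI)
        fix i j assume ij: "i < n" "j < n" "i \<noteq> j"
        show "\<beta> (e' i) (e' j) = 0"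
          using ij orth[of i] orth[of j] uv' W' eD(1)[of i] eD(1)[of j] eD(3)[of i j]
            sym[of v' u'] sym[of u' "e j"] sym[of v' "e j"]
          by (auto simp: e'_def)
      qed (use eD W' uu vv ab in \<open>auto simp: e'_def\<close>)
      moreover have "\<beta> (e' i) (e' i) = 1" if "i < Suc k" "Suc i < n" for i
        using that e1 uu by (auto simp: e'_def less_Suc_eq)
      ultimately show ?thesis by blast
    qed
  qed
  from this[of n] show ?thesis using Suc_lessD by blast
qed

text \<open>Used to remove a square factor from a single diagonal value.\<close>

lemma orthogonal_basis_rescale:
  assumes "orthogonal_basis e" "s \<noteq> 0"
  shows "orthogonal_basis (e(k := scale s (e k)))"
  using assms unfolding orthogonal_basis_def
  by (auto simp: scale_left scale_right)

end

text \<open>The isometry sends \<open>e1 i\<close> to \<open>e2 i\<close>. Defining it through the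
  coefficients \<open>c v i\<close>, themselves values of the form, makes linearity immediate; the
  same formula in the other direction gives the inverse.\<close>

lemma isometry_of_orthogonal_bases:
  assumes V: "sym_form s1 UNIV C1 n \<beta>1" and W: "sym_form s2 W C2 n \<beta>2"
    and e1: "sym_form.orthogonal_basis UNIV n \<beta>1 e1" and e2: "sym_form.orthogonal_basis W n \<beta>2 e2"
    and eq: "\<And>i. i < n \<Longrightarrow> \<beta>1 (e1 i) (e1 i) = \<beta>2 (e2 i) (e2 i)"
  shows "\<exists>\<phi>. Vector_Spaces.linear s1 s2 \<phi> \<and> bij_betw \<phi> UNIV W \<and> (\<forall>v. \<beta>1 v v = \<beta>2 (\<phi> v) (\<phi> v))"
proof -
  interpret V: sym_form s1 UNIV C1 n \<beta>1 by (rule V)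
  interpret W: sym_form s2 W C2 n \<beta>2 by (rule W)
  note e1D = V.orthogonal_basisD[OF e1] and e2D = W.orthogonal_basisD[OF e2]
  define c where "c v i = \<beta>1 v (e1 i) / \<beta>1 (e1 i) (e1 i)" for v i
  define d where "d x i = \<beta>2 x (e2 i) / \<beta>2 (e2 i) (e2 i)" for x i
  define \<phi> where "\<phi> v = (\<Sum>i<n. s2 (c v i) (e2 i))" for v
  define \<psi> where "\<psi> x = (\<Sum>i<n. s1 (d x i) (e1 i))" for x
  have expand1: "(\<Sum>i<n. s1 (c v i) (e1 i)) = v" for v
    unfolding c_def using V.orthogonal_expansion[OF e1] by simp
  have expand2: "(\<Sum>i<n. s2 (d x i) (e2 i)) = x" if "x \<in> W" for x
    unfolding d_def using W.orthogonal_expansion[OF e2 that] .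
  have "Vector_Spaces.linear s1 s2 \<phi>"
    unfolding Vector_Spaces.linear_iff
  proof (intro conjI allI V.vector_space_axioms W.vector_space_axioms)
    show "\<phi> (u + v) = \<phi> u + \<phi> v" for u v
      by (simp add: \<phi>_def c_def V.add_left add_divide_distrib W.scale_left_distrib sum.distrib)
    show "\<phi> (s1 r v) = s2 r (\<phi> v)" for r v
      by (simp add: \<phi>_def c_def V.scale_left W.scale_sum_right)
  qed
  moreover have "d (\<phi> v) i = c v i" if "i < n" for v i
    using W.orthogonal_sum[OF e2 that, of "c v"] e2D(2)[OF that] by (simp add: d_def \<phi>_def)
  then have "\<psi> (\<phi> v) = v" for v
    by (simp add: \<psi>_def expand1)
  moreover have "c (\<psi> x) i = d x i" if "i < n" for x i
    using V.orthogonal_sum[OF e1 that, of "d x"] e1D(2)[OF that] by (simp add: c_def \<psi>_def)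
  then have "\<phi> (\<psi> x) = x" if "x \<in> W" for x
    using expand2[OF that] by (simp add: \<phi>_def)
  moreover have "\<phi> v \<in> W" for v
    unfolding \<phi>_def using e2D(1) by (intro W.sum_closed W.W_closed) auto
  ultimately have "bij_betw \<phi> UNIV W"
    by (intro bij_betwI[where g = \<psi>]) auto
  moreover have "\<beta>1 v v = \<beta>2 (\<phi> v) (\<phi> v)" for v
  proof -
    have "\<beta>1 v v = (\<Sum>i<n. (c v i)\<^sup>2 * \<beta>1 (e1 i) (e1 i))"
      using V.orthogonal_sum_square[OF e1, of "c v"] by (simp add: expand1)
    also have "\<dots> = \<beta>2 (\<phi> v) (\<phi> v)"
      unfolding \<phi>_def W.orthogonal_sum_square[OF e2] using eq by simp
    finally show ?thesis .
  qed
  ultimately show ?thesis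
    using \<open>Vector_Spaces.linear s1 s2 \<phi>\<close> by blast
qed


section \<open>Rational points on \<open>c Y\<^sup>2 = p(X)\<close>\<close>

interpretation to_ac: field_hom to_ac
  by unfold_locales simp_all

interpretation map_to_ac: map_poly_inj_idom_hom to_ac ..

text \<open>This is Eisenstein's argument at the prime X - r over the closure, which divides
  \<open>p\<close> exactly once because \<open>r\<close> is a simple root.\<close>

lemma absolutely_irreducible_square_curve:
  fixes p :: "'a::field poly"
  assumes c: "c \<noteq> 0" and r: "poly (map_poly to_ac p) r = 0" "poly (pderiv (map_poly to_ac p)) r \<noteq> 0"
  shows "absolutely_irreducible [:- p, 0, [:c:]:]"
proof -
  define P where "P = map_poly to_ac p"
  define C where "C = [:to_ac c:]"
  have C: "C \<noteq> 0" "is_unit C"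
    using c by (auto simp: C_def is_unit_pCons_iff)
  have "Factorial_Ring.irreducible [:- P, 0, C:]"
  proof (rule Factorial_Ring.irreducibleI)
    show "[:- P, 0, C:] \<noteq> 0" using C by simp
    show "\<not> is_unit [:- P, 0, C:]"
      using C by (auto simp: is_unit_poly_iff)
    fix A B assume AB: "[:- P, 0, C:] = A * B"
    then have ABn: "A \<noteq> 0" "B \<noteq> 0" using C by auto
    then have deg: "degree A + degree B = 2"
      using C degree_mult_eq[of A B] by (simp flip: AB)
    \<comment> \<open>A factor free of Y divides the leading coefficient \<open>C\<close>, which is
      a unit.\<close>
    have unit0: "is_unit D" if D: "D dvd [:- P, 0, C:]" "degree D = 0" for D
    proof -
      obtain d where d: "D = [:d:]" using degree_eq_zeroE[OF D(2)] .
      have "d dvd coeff [:- P, 0, C:] 2"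
        using D(1) unfolding d const_poly_dvd_iff by blast
      then have "d dvd C" by (simp add: numeral_2_eq_2)
      then have "is_unit d" using C(2) dvd_trans by blast
      then show ?thesis by (simp add: d is_unit_const_poly_iff)
    qed
    show "is_unit A \<or> is_unit B"
    proof (cases "degree A = 1 \<and> degree B = 1")
      case False
      then have "degree A = 0 \<or> degree B = 0" using deg by linarith
      then show ?thesis using unit0 AB by (metis dvd_triv_left dvd_triv_right)
    next
      case True
      have lin: "\<exists>d0 d1. D = [:d0, d1:]" if "degree D = 1" for D :: "'a alg_closure poly poly"
      proof -
        obtain d0 D' where D': "D = pCons d0 D'" by (cases D)
        then have "degree D' = 0" using that by (simp add: degree_pCons_eq_if split: if_splits)
        then show ?thesis using D' by (metis degree_eq_zeroE)
      qed
      obtain a0 a1 b0 b1 where A: "A = [:a0, a1:]" and B: "B = [:b0, b1:]"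
        using lin True by blast
      have e: "a0 * b0 = - P" "a0 * b1 + a1 * b0 = 0" "a1 * b1 = C"
        using AB unfolding A B by (simp_all add: algebra_simps)
      have rP: "poly P r = 0" "poly (pderiv P) r \<noteq> 0"
        using r by (simp_all add: P_def)
      \<comment> \<open>At X = r the leading coefficients do not vanish, so \<open>e1\<close> and
        \<open>e2\<close> force both \<open>a0\<close> and \<open>b0\<close> to vanish there. Then
        \<open>a0 * b0 = - P\<close> has a multiple root at \<open>r\<close>.\<close>
      have Cr: "poly a1 r * poly b1 r \<noteq> 0"
        using arg_cong[OF e(3), of "\<lambda>p. poly p r"] c by (simp add: C_def)
      have e1: "poly a0 r * poly b0 r = 0"
        using arg_cong[OF e(1), of "\<lambda>p. poly p r"] rP by simp
      have e2: "poly a0 r * poly b1 r + poly a1 r * poly b0 r = 0"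
        using arg_cong[OF e(2), of "\<lambda>p. poly p r"] by simp
      have "poly a0 r = 0" "poly b0 r = 0"
        using Cr e1 e2 by auto
      moreover have "pderiv P = - pderiv (a0 * b0)"
        by (simp add: e(1) pderiv_minus)
      ultimately show ?thesis
        using rP by (simp add: pderiv_mult)
    qed
  qed
  then show ?thesis
    by (simp add: absolutely_irreducible_def P_def C_def map_to_ac.map_poly_pCons_hom to_ac.map_poly_pCons_hom map_to_ac.hom_uminus)
qed

lemma PAC_infinite_square_curve:
  fixes p :: "'a::field poly"
  assumes "PAC TYPE('a)" "c \<noteq> 0"
    and "poly (map_poly to_ac p) r = 0" "poly (pderiv (map_poly to_ac p)) r \<noteq> 0"
  shows "infinite {(x, y). c * y\<^sup>2 = poly p x}"
proof -
  have "infinite {(x, y). poly (poly [:- p, 0, [:c:]:] [:y:]) x = 0}"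
    using absolutely_irreducible_square_curve[OF assms(2-4)] assms(1) unfolding PAC_def by blast
  also have "{(x, y). poly (poly [:- p, 0, [:c:]:] [:y:]) x = 0} = {(x, y). c * y\<^sup>2 = poly p x}"
    by (simp add: power2_eq_square algebra_simps)
  finally show ?thesis .
qed

text \<open>Over a finite field the curve Y^2 = X would have only finitely many points.\<close>

lemma PAC_infinite:
  assumes "PAC TYPE('a::field)"
  shows "infinite (UNIV :: 'a set)"
proof
  assume "finite (UNIV :: 'a set)"
  then have "finite (UNIV :: ('a \<times> 'a) set)"
    by (simp add: finite_Prod_UNIV)
  moreover have "infinite {(x, y). 1 * y\<^sup>2 = poly [:0, 1 :: 'a:] x}"
    by (rule PAC_infinite_square_curve[OF assms, where r = 0]) (simp_all add: map_poly_pCons pderiv_pCons)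
  ultimately show False
    using finite_subset subset_UNIV by blast
qed

text \<open>Points are taken on b Y^2 = 1 - a X^2. A root \<open>r\<close> of the right side is
  nonzero, so the derivative -2 a r is nonzero in characteristic other than 2.\<close>

lemma PAC_binary_form:
  fixes a b :: "'a::field"
  assumes "PAC TYPE('a)" "(2::'a) \<noteq> 0" "a \<noteq> 0" "b \<noteq> 0"
  shows "\<exists>x y. a * x\<^sup>2 + b * y\<^sup>2 = 1"
proof -
  let ?p = "[:1, 0, - a:]"
  have map: "map_poly to_ac ?p = [:1, 0, - to_ac a:]"
    by (simp add: to_ac.map_poly_pCons_hom)
  obtain r where r: "poly (map_poly to_ac ?p) r = 0"
    using alg_closed_imp_poly_has_root[of "map_poly to_ac ?p"] assms(3) by (auto simp: map)
  have "poly (pderiv (map_poly to_ac ?p)) r = - (2 * to_ac a * r)"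
    unfolding map by (simp add: pderiv_pCons algebra_simps)
  moreover have "r \<noteq> 0" using r unfolding map by auto
  moreover have "(2 :: 'a alg_closure) = to_ac 2" by simp
  then have "(2 :: 'a alg_closure) \<noteq> 0" using assms(2) by (metis to_ac.hom_0_iff)
  ultimately have "poly (pderiv (map_poly to_ac ?p)) r \<noteq> 0"
    using assms(3) by simp
  then have "infinite {(x, y). b * y\<^sup>2 = poly ?p x}"
    using PAC_infinite_square_curve[OF assms(1,4) r] by blast
  then obtain x y where "b * y\<^sup>2 = poly ?p x"
    using infinite_imp_nonempty by blast
  then have "a * x\<^sup>2 + b * y\<^sup>2 = 1"
    by (simp add: power2_eq_square algebra_simps)
  then show ?thesis by blast
qed


section \<open>Primitive elements\<close>

lemma simple_root_pderiv:
  fixes p :: "'b::field poly"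
  assumes "rsquarefree p" "poly p a = 0"
  shows "poly (pderiv p) a \<noteq> 0"
proof -
  have p: "p \<noteq> 0"
    using assms by (simp add: rsquarefree_def)
  have "order a p = 0 \<or> order a p = 1"
    using assms unfolding rsquarefree_def by blast
  then have "order a p = 1"
    using assms order_root[of p a] p by auto
  then obtain k where k: "p = [:- a, 1:] * k" and nd: "\<not> [:- a, 1:] dvd k"
    using order_decomp[OF p, of a] by auto
  have "poly k a \<noteq> 0"
    using nd by (simp add: poly_eq_0_iff_dvd)
  then show ?thesis
    by (simp add: k pderiv_mult pderiv_pCons del: mult_pCons_left)
qed

section \<open>Polynomials over a subfield of an algebraically closed field\<close>

locale subfield_set =
  fixes L :: "'b::alg_closed_field set"
  assumes zero: "0 \<in> L" and one: "1 \<in> L"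
    and add: "\<And>x y. x \<in> L \<Longrightarrow> y \<in> L \<Longrightarrow> x + y \<in> L"
    and mult: "\<And>x y. x \<in> L \<Longrightarrow> y \<in> L \<Longrightarrow> x * y \<in> L"
    and minus: "\<And>x. x \<in> L \<Longrightarrow> - x \<in> L"
    and inverse: "\<And>x. x \<in> L \<Longrightarrow> inverse x \<in> L"
begin

lemma diff: "x \<in> L \<Longrightarrow> y \<in> L \<Longrightarrow> x - y \<in> L"
  using add[of x "- y"] minus by simp

lemma divide: "x \<in> L \<Longrightarrow> y \<in> L \<Longrightarrow> x / y \<in> L"
  using mult inverse by (simp add: field_class.field_divide_inverse)

lemma sum: "(\<And>i. i \<in> I \<Longrightarrow> f i \<in> L) \<Longrightarrow> sum f I \<in> L"
  by (induction I rule: infinite_finite_induct) (auto intro: zero add)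

text \<open>Polynomials over \<open>L\<close> stay in the polynomial type of the big field, where
  they can be evaluated and factored without transfer.\<close>

definition coeffs_in :: "'b poly \<Rightarrow> bool" where
  "coeffs_in p \<longleftrightarrow> (\<forall>i. coeff p i \<in> L)"

lemma coeffs_in_mult: "coeffs_in p \<Longrightarrow> coeffs_in q \<Longrightarrow> coeffs_in (p * q)"
  by (simp add: coeffs_in_def coeff_mult mult sum)

lemma coeffs_in_pCons: "a \<in> L \<Longrightarrow> coeffs_in p \<Longrightarrow> coeffs_in (pCons a p)"
  by (simp add: coeffs_in_def coeff_pCons split: nat.split)

lemma coeffs_in_0: "coeffs_in 0"
  by (simp add: coeffs_in_def zero)

lemma coeffs_in_add: "coeffs_in p \<Longrightarrow> coeffs_in q \<Longrightarrow> coeffs_in (p + q)"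
  by (simp add: coeffs_in_def add)

lemma coeffs_in_diff: "coeffs_in p \<Longrightarrow> coeffs_in q \<Longrightarrow> coeffs_in (p - q)"
  by (simp add: coeffs_in_def diff)

lemma coeffs_in_monom: "a \<in> L \<Longrightarrow> coeffs_in (monom a k)"
  by (simp add: coeffs_in_def zero)

lemma coeffs_in_pcompose:
  assumes "coeffs_in p" "coeffs_in q"
  shows "coeffs_in (pcompose p q)"
  using assms(1)
proof (induction p)
  case (pCons a p)
  then have "a \<in> L" "coeffs_in p"
    unfolding coeffs_in_def by (metis coeff_pCons_0, metis coeff_pCons_Suc)
  then show ?case
    using pCons assms(2) by (simp add: pcompose_pCons coeffs_in_add coeffs_in_mult coeffs_in_pCons coeffs_in_0)
qed (simp add: coeffs_in_0)

text \<open>Long division by \<open>m\<close>: cancelling the leading term of \<open>p\<close> with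
  a monomial multiple of \<open>m\<close> uses only operations of \<open>L\<close> and keeps the
  root \<open>b\<close>, and minimality ensures that the degree of a nonzero \<open>p\<close> never
  falls below that of \<open>m\<close>.\<close>

lemma minimal_dvd:
  assumes m: "coeffs_in m" "m \<noteq> 0" "poly m b = 0"
    and min: "\<And>p. coeffs_in p \<Longrightarrow> p \<noteq> 0 \<Longrightarrow> poly p b = 0 \<Longrightarrow> degree m \<le> degree p"
    and p: "coeffs_in p" "poly p b = 0"
  shows "m dvd p"
  using p
proof (induction "degree p" arbitrary: p rule: less_induct)
  case less
  show ?case
  proof (cases "p = 0")
    case False
    define t where "t = monom (lead_coeff p / lead_coeff m) (degree p - degree m)"
    have le: "degree m \<le> degree p"
      using min False less.prems by blast
    have t0: "t \<noteq> 0"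
      using False m(2) by (simp add: t_def)
    have tc: "coeffs_in t"
      using less.prems m unfolding t_def by (intro coeffs_in_monom divide) (auto simp: coeffs_in_def)
    define q where "q = p - t * m"
    have "coeffs_in q"
      using less.prems m tc by (simp add: q_def coeffs_in_diff coeffs_in_mult)
    moreover have "poly q b = 0"
      using less.prems m by (simp add: q_def)
    moreover have "q = 0 \<or> degree q < degree p"
    proof (rule eq_zero_or_degree_less)
      have "degree (t * m) = degree p"
        using t0 m(2) le False by (simp add: degree_mult_eq degree_monom_eq t_def)
      moreover from this have "coeff (t * m) (degree p) = lead_coeff p"
        using m(2) lead_coeff_mult[of t m] t0 False by (simp add: t_def degree_monom_eq)
      ultimately show "degree q \<le> degree p" "coeff q (degree p) = 0"
        by (simp_all add: q_def degree_diff_le)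
    qed
    ultimately have "m dvd q"
      using less.hyps by fastforce
    then have "m dvd q + t * m" by simp
    then show ?thesis by (simp add: q_def)
  qed simp
qed


text \<open>This replaces the gcd of \<open>g\<close> and \<open>h\<close> over \<open>L\<close> in the primitive element theorem: the minimal
  polynomial of \<open>b\<close> over \<open>L\<close> divides both.\<close>

lemma unique_common_root_in:
  assumes g: "coeffs_in g" "poly g b = 0" "poly (pderiv g) b \<noteq> 0"
    and h: "coeffs_in h" "poly h b = 0"
    and common: "\<And>r. poly g r = 0 \<Longrightarrow> poly h r = 0 \<Longrightarrow> r = b"
  shows "b \<in> L"
proof -
  define P where "P m \<longleftrightarrow> coeffs_in m \<and> m \<noteq> 0 \<and> poly m b = 0" for m
  have "P g" using g by (auto simp: P_def)
  then obtain m where m: "P m" and min: "\<And>p. P p \<Longrightarrow> degree m \<le> degree p"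
    using ex_has_least_nat[of P g degree] by blast
  have dvd: "m dvd p" if "coeffs_in p" "poly p b = 0" for p
    using minimal_dvd[of m b p] m min that unfolding P_def by blast
  obtain u where u: "g = m * u" using dvd[OF g(1,2)] by (elim dvdE)
  obtain w where w: "h = m * w" using dvd[OF h] by (elim dvdE)
  obtain k where k: "m = [:- b, 1:] * k"
    using m unfolding P_def poly_eq_0_iff_dvd by (elim conjE dvdE)
  have "g = [:- b, 1:] * (k * u)"
    by (simp only: u k mult.assoc)
  then have kb: "poly k b \<noteq> 0"
    using g(3) by (auto simp: pderiv_mult pderiv_pCons simp del: mult_pCons_left)
  \<comment> \<open>A root of \<open>k\<close> would be a common root of \<open>g\<close> and
    \<open>h\<close>, hence \<open>b\<close>; but \<open>b\<close> is a simple root of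
    \<open>g\<close>, so \<open>k\<close> does not vanish at it.\<close>
  have "degree k = 0"
  proof (rule ccontr)
    assume "degree k \<noteq> 0"
    then obtain r where r: "poly k r = 0"
      using alg_closed_imp_poly_has_root by blast
    then have "r = b"
      by (intro common) (simp_all add: u w k)
    with r kb show False by simp
  qed
  then obtain \<kappa> where \<kappa>: "k = [:\<kappa>:]"
    by (elim degree_eq_zeroE)
  have "\<kappa> \<noteq> 0" using kb \<kappa> by simp
  \<comment> \<open>\<open>m\<close> is linear with root \<open>b\<close>, so \<open>b\<close> is a
    quotient of elements of \<open>L\<close>.\<close>
  have "coeff m 0 = - b * \<kappa>" "coeff m 1 = \<kappa>"
    by (simp_all add: k \<kappa>)
  then have "b = - (coeff m 0 / coeff m 1)"
    using \<open>\<kappa> \<noteq> 0\<close> by simp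
  moreover have "- (coeff m 0 / coeff m 1) \<in> L"
    using m by (intro minus divide) (auto simp: P_def coeffs_in_def)
  ultimately show ?thesis by simp
qed

end

section \<open>Simple extensions and the primitive element theorem\<close>

definition adjoin :: "'a::field alg_closure \<Rightarrow> 'a alg_closure set" where
  "adjoin x = range (\<lambda>p. poly (map_poly to_ac p) x)"

lemma poly_in_adjoin: "poly (map_poly to_ac p) x \<in> adjoin x"
  by (simp add: adjoin_def)

lemma self_in_adjoin: "x \<in> adjoin x"
  using poly_in_adjoin[of "[:0, 1:]" x] by (simp add: to_ac.map_poly_pCons_hom)

lemma to_ac_in_adjoin: "to_ac c \<in> adjoin x"
  using poly_in_adjoin[of "[:c:]" x] by (simp add: to_ac.map_poly_pCons_hom)

lemma adjoin_subset:
  assumes "y \<in> adjoin x"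
  shows "adjoin y \<subseteq> adjoin x"
proof -
  obtain p where p: "y = poly (map_poly to_ac p) x"
    using assms by (auto simp: adjoin_def)
  have "poly (map_poly to_ac q) y = poly (map_poly to_ac (pcompose q p)) x" for q
    by (simp add: p to_ac.map_poly_pcompose poly_pcompose)
  then show ?thesis
    by (auto simp: adjoin_def)
qed

text \<open>This makes the ring K[x] the field K(x). A polynomial relation for nonzero
  \<open>x\<close> is stripped of factors X until its constant term is nonzero; dividing by that
  term exhibits the inverse.\<close>

lemma inverse_in_adjoin: "inverse x \<in> adjoin x"
proof (cases "x = 0")
  case True
  then show ?thesis using to_ac_in_adjoin[of 0 x] by simp
next
  case x: False
  have "inverse x \<in> adjoin x" if "p \<noteq> 0" "poly (map_poly to_ac p) x = 0" for p
    using that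
  proof (induction p)
    case (pCons a p)
    have eq: "to_ac a + x * poly (map_poly to_ac p) x = 0"
      using pCons.prems by (simp add: to_ac.map_poly_pCons_hom)
    show ?case
    proof (cases "a = 0")
      case True
      then have "p \<noteq> 0" "poly (map_poly to_ac p) x = 0"
        using eq x pCons.prems(1) by auto
      then show ?thesis using pCons.IH by blast
    next
      case False
      have "x * poly (map_poly to_ac (smult (- inverse a) p)) x =
          - inverse (to_ac a) * (x * poly (map_poly to_ac p) x)"
        unfolding to_ac.map_poly_hom_smult by (simp add: mult_ac)
      also have "x * poly (map_poly to_ac p) x = - to_ac a"
        using eq by (simp add: add_eq_0_iff)
      finally have "x * poly (map_poly to_ac (smult (- inverse a) p)) x = 1"
        using False by simp
      then show ?thesis
        using poly_in_adjoin inverse_unique by metis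
    qed
  qed simp
  then show ?thesis using alg_closure_algebraic by blast
qed

lemma subfield_set_adjoin: "subfield_set (adjoin x)"
proof
  fix y z assume "y \<in> adjoin x" "z \<in> adjoin x"
  then obtain p q where "y = poly (map_poly to_ac p) x" "z = poly (map_poly to_ac q) x"
    by (auto simp: adjoin_def)
  then have "y + z = poly (map_poly to_ac (p + q)) x" "y * z = poly (map_poly to_ac (p * q)) x"
    by (simp_all add: map_to_ac.hom_add map_to_ac.hom_mult)
  then show "y + z \<in> adjoin x" "y * z \<in> adjoin x"
    using poly_in_adjoin by metis+
next
  fix y assume y: "y \<in> adjoin x"
  then obtain p where "y = poly (map_poly to_ac p) x"
    by (auto simp: adjoin_def)
  then have "- y = poly (map_poly to_ac (- p)) x"
    by (simp add: map_to_ac.hom_uminus)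
  then show "- y \<in> adjoin x"
    using poly_in_adjoin by metis
  show "inverse y \<in> adjoin x"
    using inverse_in_adjoin adjoin_subset[OF y] by blast
qed (use to_ac_in_adjoin[of 0] to_ac_in_adjoin[of 1] in simp_all)

lemma subspace_adjoin: "ac.subspace (adjoin x)"
proof -
  interpret subfield_set "adjoin x" by (rule subfield_set_adjoin)
  show ?thesis
    unfolding ac.subspace_def ac_scale_def by (intro conjI allI ballI zero add mult to_ac_in_adjoin)
qed

text \<open>The classical argument: for all but finitely many \<open>c\<close>, the element \<theta>
  + c b generates both. Only \<open>b\<close> has to be separable.\<close>

lemma adjoin_two_separable:
  fixes \<theta> b :: "'a::field alg_closure"
  assumes inf: "infinite (UNIV :: 'a set)" and sep: "separable_element b"
  shows "\<exists>c. \<theta> \<in> adjoin (\<theta> + to_ac c * b) \<and> b \<in> adjoin (\<theta> + to_ac c * b)"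
proof -
  obtain f :: "'a poly" where f: "f \<noteq> 0" "poly (map_poly to_ac f) \<theta> = 0"
    using alg_closure_algebraic by blast
  obtain g :: "'a poly" where g: "poly (map_poly to_ac g) b = 0" "rsquarefree (map_poly to_ac g)"
    using sep by (auto simp: separable_element_def separable_poly_def)
  have g0: "map_poly to_ac g \<noteq> 0" using g(2) by (simp add: rsquarefree_def)
  \<comment> \<open>These are the \<open>c\<close> with \<theta> + c b = u + c r for some root u of
    f and some root r of g other than \<open>b\<close>. Pairs with r = b divide by zero and merely
    add the value 0.\<close>
  define bad where "bad = (\<lambda>(u, r). (u - \<theta>) / (b - r)) `
    ({u. poly (map_poly to_ac f) u = 0} \<times> {r. poly (map_poly to_ac g) r = 0})"
  have "finite bad"
    unfolding bad_def using f(1) g0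
    by (intro finite_imageI finite_cartesian_product poly_roots_finite) simp_all
  then have "finite (to_ac -` bad :: 'a set)"
    by (intro finite_vimageI) (simp_all add: inj_def)
  then obtain c :: 'a where c: "to_ac c \<notin> bad"
    using ex_new_if_finite[OF inf] by blast
  define \<gamma> where "\<gamma> = \<theta> + to_ac c * b"
  interpret subfield_set "adjoin \<gamma>" by (rule subfield_set_adjoin)
  have K: "coeffs_in (map_poly to_ac p)" for p
    by (simp add: coeffs_in_def to_ac_in_adjoin)
  \<comment> \<open>h(r) = f(\<gamma> - c r) vanishes at \<open>b\<close>. A further common root r
    of \<open>g\<close> and \<open>h\<close> would make \<gamma> - c r a root u of \<open>f\<close>
    and thus put c in \<open>bad\<close>.\<close>
  define h where "h = pcompose (map_poly to_ac f) [:\<gamma>, - to_ac c:]"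
  have hr: "poly h r = poly (map_poly to_ac f) (\<gamma> - to_ac c * r)" for r
    by (simp add: h_def poly_pcompose mult.commute)
  have b: "b \<in> adjoin \<gamma>"
  proof (rule unique_common_root_in[OF K g(1)])
    show "poly (pderiv (map_poly to_ac g)) b \<noteq> 0"
      using simple_root_pderiv g by blast
    show "coeffs_in h"
      unfolding h_def
      by (intro coeffs_in_pcompose K coeffs_in_pCons self_in_adjoin minus to_ac_in_adjoin coeffs_in_0)
    show "poly h b = 0"
      using f by (simp add: hr \<gamma>_def)
    fix r assume r: "poly (map_poly to_ac g) r = 0" "poly h r = 0"
    show "r = b"
    proof (rule ccontr)
      assume "r \<noteq> b"
      then have "to_ac c = ((\<gamma> - to_ac c * r) - \<theta>) / (b - r)"
        by (simp add: \<gamma>_def field_simps)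
      then have "to_ac c \<in> bad"
        using r unfolding bad_def hr by force
      with c show False by simp
    qed
  qed
  have "\<gamma> - to_ac c * b \<in> adjoin \<gamma>"
    by (intro diff mult self_in_adjoin to_ac_in_adjoin b)
  with b show ?thesis
    unfolding \<gamma>_def by auto
qed

lemma (in vector_space) subspace_eq_of_dim_le:
  assumes "subspace S" "S \<subseteq> T" "T \<subseteq> span B" "finite B" "dim T \<le> dim S"
  shows "S = T"
proof -
  obtain C where C: "C \<subseteq> S" "independent C" "S \<subseteq> span C" "card C = dim S"
    using basis_exists .
  obtain D where D: "C \<subseteq> D" "D \<subseteq> T" "independent D" "T \<subseteq> span D"
    using maximal_independent_subset_extend[of C T] C assms(2) by blast
  have "finite D"
    using independent_span_bound[OF assms(4) D(3)] D(2) assms(3) by blast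
  moreover have "card D = dim T"
    using basis_card_eq_dim D by blast
  ultimately have "C = D"
    using card_seteq[of D C] D(1) C(4) assms(5) by simp
  then have "T \<subseteq> S"
    using D(4) span_minimal[OF C(1) assms(1)] by blast
  with assms(2) show ?thesis by blast
qed

text \<open>Inverses come from K(x) being contained in \<open>F\<close> for each x in
  \<open>F\<close>, negatives from multiplication by -1.\<close>

lemma subfield_set_of_subfield:
  assumes F: "subfield F ring_of_type_algebra" and K: "range to_ac \<subseteq> (F :: 'a::field alg_closure set)"
  shows "subfield_set F"
proof -
  interpret ring "ring_of_type_algebra :: 'a alg_closure ring"
    by (rule ring_from_type_algebra)
  note E = subringE[OF subfieldE(1)[OF F]]
  have add: "x + y \<in> F" and mult: "x * y \<in> F" if "x \<in> F" "y \<in> F" for x y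
    using E(6,7)[OF that] by (simp_all add: ring_of_type_algebra_def)
  have K': "to_ac c \<in> F" for c using K by blast
  have "poly (map_poly to_ac p) x \<in> F" if "x \<in> F" for p x
    by (induction p) (use that add mult K' K'[of 0] in \<open>simp_all add: to_ac.map_poly_pCons_hom\<close>)
  then have "adjoin x \<subseteq> F" if "x \<in> F" for x
    using that by (auto simp: adjoin_def)
  moreover have "- x \<in> F" if "x \<in> F" for x
    using mult[OF K'[of "- 1"] that] by simp
  ultimately show ?thesis
    using add mult K'[of 0] K'[of 1] by unfold_locales (simp_all add: subsetD[OF _ inverse_in_adjoin])
qed

locale finite_sep_ext =
  fixes F :: "'a::field alg_closure set"
  assumes F: "finite_separable_extension F" and infinite_base: "infinite (UNIV :: 'a set)"
begin

sublocale subfield_set F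
  using F subfield_set_of_subfield unfolding finite_separable_extension_def by blast

lemma to_ac_in [simp]: "to_ac c \<in> F"
  using F unfolding finite_separable_extension_def by blast

lemma adjoin_in: "x \<in> F \<Longrightarrow> adjoin x \<subseteq> F"
proof -
  assume "x \<in> F"
  then have "poly (map_poly to_ac p) x \<in> F" for p
    by (induction p) (simp_all add: to_ac.map_poly_pCons_hom zero add mult)
  then show ?thesis by (auto simp: adjoin_def)
qed

text \<open>Take \<theta> in \<open>F\<close> with K(\<theta>) of maximal dimension. For
  \<open>b\<close> in \<open>F\<close>, \<theta> and \<open>b\<close> lie in a common K(\<gamma>),
  which maximality forces to equal K(\<theta>).\<close>

lemma ex_primitive_element: "\<exists>\<theta>\<in>F. adjoin \<theta> = F"
proof -
  obtain B where B: "finite B" "ac.span B = F"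
    using F unfolding finite_separable_extension_def basis_of_def by blast
  have "ac.dim (adjoin x) < Suc (card B)" if "x \<in> F" for x
    using ac.dim_le_card[of "adjoin x" B] adjoin_in[OF that] B by simp
  then have "\<exists>\<theta>. \<theta> \<in> F \<and> (\<forall>\<gamma>. \<gamma> \<in> F \<longrightarrow> ac.dim (adjoin \<gamma>) \<le> ac.dim (adjoin \<theta>))"
    by (intro ex_has_greatest_nat[of _ 0 _ "Suc (card B)"]) (simp_all add: zero)
  then obtain \<theta> where \<theta>: "\<theta> \<in> F" and max: "\<And>\<gamma>. \<gamma> \<in> F \<Longrightarrow> ac.dim (adjoin \<gamma>) \<le> ac.dim (adjoin \<theta>)"
    by blast
  have "b \<in> adjoin \<theta>" if b: "b \<in> F" for b
  proof -
    have "separable_element b"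
      using F b unfolding finite_separable_extension_def by blast
    then obtain c where c: "\<theta> \<in> adjoin (\<theta> + to_ac c * b)" "b \<in> adjoin (\<theta> + to_ac c * b)"
      using adjoin_two_separable[OF infinite_base] by blast
    define \<gamma> where "\<gamma> = \<theta> + to_ac c * b"
    have "\<gamma> \<in> F" using \<theta> b by (simp add: \<gamma>_def add mult)
    then have "adjoin \<theta> = adjoin \<gamma>"
      using c(1) B max adjoin_in[of \<gamma>]
      by (intro ac.subspace_eq_of_dim_le[of _ _ B] subspace_adjoin adjoin_subset) (simp_all add: \<gamma>_def)
    then show ?thesis using c(2) by (simp add: \<gamma>_def)
  qed
  with \<theta> adjoin_in show ?thesis by blast
qed

end


section \<open>Trace and norm\<close>

context finite_sep_ext
begin

text \<open>The choice term is the one inside \<open>field_trace\<close>, so the trace is by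
  definition computed in this basis.\<close>

definition B :: "'a alg_closure set" where "B = (SOME B. basis_of F B)"

abbreviation n :: nat where "n \<equiv> ext_degree F"

lemma basis_B: "ac.independent B" "ac.span B = F" "finite B" "card B = n"
proof -
  obtain B0 where B0: "finite B0" "basis_of F B0"
    using F unfolding finite_separable_extension_def by blast
  then have "basis_of F B"
    unfolding B_def by (intro someI[of "basis_of F"])
  then show i: "ac.independent B" and s: "ac.span B = F"
    by (auto simp: basis_of_def)
  show "finite B"
    using ac.independent_span_bound[OF B0(1) i] B0(2) ac.span_superset[of B] s
    by (simp add: basis_of_def)
  show "card B = n"
    using ac.dim_span_eq_card_independent[OF i] s by simp
qed

definition bs :: "nat \<Rightarrow> 'a alg_closure" where "bs = (SOME f. bij_betw f {..<n} B)"

lemma bij_bs: "bij_betw bs {..<n} B"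
proof -
  have "\<exists>f. bij_betw f {..<n} B"
    using ex_bij_betw_nat_finite[OF basis_B(3)] basis_B(4) by (simp add: atLeast0LessThan)
  then show ?thesis
    unfolding bs_def by (rule someI_ex)
qed

lemma bs_in_B: "i < n \<Longrightarrow> bs i \<in> B"
  using bij_bs by (auto simp: bij_betw_def)

lemma bs_in [simp]: "i < n \<Longrightarrow> bs i \<in> F"
  using bs_in_B ac.span_superset[of B] basis_B(2) by blast

definition crd :: "'a alg_closure \<Rightarrow> nat \<Rightarrow> 'a" where
  "crd x i = ac.representation B x (bs i)"

lemma crd_add: "x \<in> F \<Longrightarrow> y \<in> F \<Longrightarrow> crd (x + y) i = crd x i + crd y i"
  unfolding crd_def using ac.representation_add[of B] basis_B by simp

lemma crd_scale: "x \<in> F \<Longrightarrow> crd (to_ac c * x) i = c * crd x i"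
  unfolding crd_def using ac.representation_scale[of B x c] basis_B by (simp add: ac_scale_def)

lemma crd_0 [simp]: "crd 0 i = 0"
  using crd_scale[of 0 0 i] by (simp add: zero)

lemma crd_sum: "(\<And>k. k \<in> I \<Longrightarrow> f k \<in> F) \<Longrightarrow> crd (\<Sum>k\<in>I. f k) i = (\<Sum>k\<in>I. crd (f k) i)"
  by (induction I rule: infinite_finite_induct) (simp_all add: crd_add sum)

lemma crd_bs: "i < n \<Longrightarrow> j < n \<Longrightarrow> crd (bs j) i = (if i = j then 1 else 0)"
  unfolding crd_def using ac.representation_basis[OF basis_B(1) bs_in_B[of j]] bij_bs
  by (auto simp: bij_betw_def inj_on_def)

lemma crd_expand: "x \<in> F \<Longrightarrow> x = (\<Sum>i<n. to_ac (crd x i) * bs i)"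
proof -
  assume x: "x \<in> F"
  have "x = (\<Sum>b\<in>B. ac_scale (ac.representation B x b) b)"
    using ac.sum_representation_eq[OF basis_B(1) _ basis_B(3)] x basis_B(2) by simp
  also have "\<dots> = (\<Sum>i<n. ac_scale (ac.representation B x (bs i)) (bs i))"
    by (rule sum.reindex_bij_betw[OF bij_bs, symmetric])
  finally show ?thesis
    by (simp add: crd_def ac_scale_def)
qed

lemma crd_mult_expand:
  assumes "x \<in> F" "y \<in> F"
  shows "crd (x * y) i = (\<Sum>k<n. crd y k * crd (x * bs k) i)"
proof -
  have "x * y = (\<Sum>k<n. to_ac (crd y k) * (x * bs k))"
    by (subst crd_expand[OF assms(2)]) (simp add: sum_distrib_left mult_ac)
  also have "crd \<dots> i = (\<Sum>k<n. crd (to_ac (crd y k) * (x * bs k)) i)"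
    using assms by (intro crd_sum mult) auto
  also have "\<dots> = (\<Sum>k<n. crd y k * crd (x * bs k) i)"
    using assms by (intro sum.cong refl crd_scale mult) auto
  finally show ?thesis .
qed

text \<open>The matrix of multiplication by \<open>x\<close>; its determinant serves as the norm of
  \<open>x\<close>.\<close>

definition mmat :: "'a alg_closure \<Rightarrow> 'a mat" where
  "mmat x = mat n n (\<lambda>(i, j). crd (x * bs j) i)"

lemma mmat_carrier [simp]: "mmat x \<in> carrier_mat n n"
  by (simp add: mmat_def)

lemma mmat_mult:
  assumes "x \<in> F" "y \<in> F"
  shows "mmat (x * y) = mmat x * mmat y"
  by (rule eq_matI)
    (use assms in \<open>auto simp: mmat_def scalar_prod_def mult.assoc mult crd_mult_expand[of x] atLeast0LessThan mult.commute intro!: sum.cong\<close>)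

lemma mmat_1: "mmat 1 = 1\<^sub>m n"
  by (rule eq_matI) (auto simp: mmat_def crd_bs)

lemma mmat_diff:
  assumes "x \<in> F"
  shows "mmat (to_ac t - x) = - char_matrix (mmat x) t"
proof (rule eq_matI)
  fix i j assume "i < dim_row (- char_matrix (mmat x) t)" "j < dim_col (- char_matrix (mmat x) t)"
  then have ij: "i < n" "j < n" by (auto simp: char_matrix_def mmat_def)
  have "(to_ac t - x) * bs j = to_ac t * bs j + to_ac (- 1) * (x * bs j)"
    by (simp add: algebra_simps)
  then have "crd ((to_ac t - x) * bs j) i = t * crd (bs j) i - crd (x * bs j) i"
    using ij assms crd_scale[of "x * bs j" "- 1" i] crd_scale[of "bs j" t i]
    by (simp only: crd_add mult to_ac_in bs_in) simp
  then show "mmat (to_ac t - x) $$ (i, j) = (- char_matrix (mmat x) t) $$ (i, j)"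
    using ij by (simp add: mmat_def char_matrix_def crd_bs)
qed (auto simp: char_matrix_def mmat_def)

text \<open>Values of the characteristic polynomial on K are norms; this later turns a rational
  point on a curve into an element of prescribed norm.\<close>

lemma poly_char_poly_mmat:
  assumes "x \<in> F"
  shows "poly (char_poly (mmat x)) t = det (mmat (to_ac t - x))"
  using char_poly_matrix[OF mmat_carrier] mmat_diff[OF assms] by simp

section \<open>The trace and its non-vanishing\<close>

definition tr :: "'a alg_closure \<Rightarrow> 'a" where "tr x = field_trace F x"

lemma tr_eq: "tr x = (\<Sum>i<n. crd (x * bs i) i)"
  unfolding tr_def field_trace_def Let_def B_def[symmetric] crd_def
  by (rule sum.reindex_bij_betw[OF bij_bs, symmetric])

lemma tr_add: "x \<in> F \<Longrightarrow> y \<in> F \<Longrightarrow> tr (x + y) = tr x + tr y"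
  by (simp add: tr_eq distrib_right crd_add mult Groups_Big.sum.distrib)

lemma tr_scale: "x \<in> F \<Longrightarrow> tr (to_ac c * x) = c * tr x"
  by (simp add: tr_eq mult.assoc crd_scale mult sum_distrib_left)

text \<open>Jacobi's formula for the derivative of the determinant \<open>det (t - \<theta>)\<close>.\<close>

lemma tr_inverse:
  assumes \<theta>: "\<theta> \<in> F" and t: "to_ac t \<noteq> \<theta>"
  shows "poly (pderiv (char_poly (mmat \<theta>))) t = det (mmat (to_ac t - \<theta>)) * tr (inverse (to_ac t - \<theta>))"
proof -
  define y where "y = to_ac t - \<theta>"
  have y: "y \<in> F" "y \<noteq> 0" using \<theta> t by (simp_all add: y_def diff)
  define N where "N = mmat y"
  have N: "N \<in> carrier_mat n n" by (simp add: N_def)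
  have adj: "adj_mat N \<in> carrier_mat n n" using adj_mat[OF N] by blast
  \<comment> \<open>The inverse of \<open>N\<close> is multiplication by the inverse of
    \<open>y\<close>, which identifies the adjugate.\<close>
  have "adj_mat N = mmat (inverse y) * N * adj_mat N"
    using y adj by (simp add: N_def inverse mmat_1 flip: mmat_mult)
  also have "\<dots> = mmat (inverse y) * (N * adj_mat N)"
    using N adj by (intro assoc_mult_mat[of _ n n _ n _ n]) simp_all
  also have "N * adj_mat N = det N \<cdot>\<^sub>m 1\<^sub>m n"
    using adj_mat[OF N] by blast
  also have "mmat (inverse y) * \<dots> = det N \<cdot>\<^sub>m mmat (inverse y)"
    by (simp add: mult_smult_distrib[of _ n n _ n] right_mult_one_mat[of _ n n])
  finally have adj_eq: "adj_mat N = det N \<cdot>\<^sub>m mmat (inverse y)" .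
  \<comment> \<open>Deleting row and column i from t - M leaves t minus the corresponding minor of
    M. The derivative of \<open>char_poly\<close> is the sum of the characteristic polynomials of
    these minors.\<close>
  have cofactor: "poly (char_poly (mat_delete (mmat \<theta>) i i)) t = adj_mat N $$ (i, i)" if i: "i < n" for i
  proof -
    have d: "mat_delete (mmat \<theta>) i i \<in> carrier_mat (n - 1) (n - 1)"
      by (rule mat_delete_carrier[OF mmat_carrier])
    have "- char_matrix (mat_delete (mmat \<theta>) i i) t = mat_delete N i i"
      unfolding N_def y_def mmat_diff[OF \<theta>] using i
      by (intro eq_matI) (auto simp: char_matrix_def mat_delete_def mmat_def)
    then have "poly (char_poly (mat_delete (mmat \<theta>) i i)) t = det (mat_delete N i i)"
      using char_poly_matrix[OF d] by simp
    also have "\<dots> = adj_mat N $$ (i, i)"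
      using N i by (simp add: adj_mat_def cofactor_def)
    finally show ?thesis .
  qed
  have "poly (pderiv (char_poly (mmat \<theta>))) t = (\<Sum>i<n. adj_mat N $$ (i, i))"
    by (simp add: pderiv_char_poly[OF mmat_carrier] poly_sum cofactor)
  also have "\<dots> = (\<Sum>i<n. det N * crd (inverse y * bs i) i)"
    by (intro sum.cong refl) (simp add: adj_eq mmat_def)
  also have "\<dots> = det N * tr (inverse y)"
    by (simp add: tr_eq sum_distrib_left)
  finally show ?thesis by (simp add: N_def y_def)
qed

text \<open>Over the closure, the vector of basis elements is an eigenvector of the transposed
  multiplication matrix with eigenvalue \<theta>.\<close>

lemma ac_poly_char_poly_root:
  assumes \<theta>: "\<theta> \<in> F"
  shows "poly (map_poly to_ac (char_poly (mmat \<theta>))) \<theta> = 0"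
proof -
  let ?A = "map_mat to_ac (mmat \<theta>)\<^sup>T"
  have A: "?A \<in> carrier_mat n n" by simp
  define v where "v = vec n bs"
  have "v \<noteq> 0\<^sub>v n"
  proof
    assume v: "v = 0\<^sub>v n"
    have "bs i = 0" if "i < n" for i
      using arg_cong[OF v, of "\<lambda>v. vec_index v i"] that by (simp add: v_def)
    then have "F = {0}"
      using crd_expand zero by fastforce
    then show False using one by simp
  qed
  moreover have "?A *\<^sub>v v = \<theta> \<cdot>\<^sub>v v"
  proof (rule eq_vecI)
    fix i assume "i < dim_vec (\<theta> \<cdot>\<^sub>v v)"
    then have i: "i < n" by (simp add: v_def)
    have "(?A *\<^sub>v v) $ i = (\<Sum>j<n. to_ac (crd (\<theta> * bs i) j) * bs j)"
      using i by (simp add: v_def scalar_prod_def mmat_def atLeast0LessThan)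
    also have "\<dots> = \<theta> * bs i"
      using crd_expand[of "\<theta> * bs i"] i \<theta> by (simp add: mult)
    finally show "(?A *\<^sub>v v) $ i = (\<theta> \<cdot>\<^sub>v v) $ i"
      using i by (simp add: v_def)
  qed (simp add: v_def mmat_def)
  ultimately have "eigenvector ?A v \<theta>"
    using A unfolding eigenvector_def by (simp add: v_def mmat_def)
  then have "poly (char_poly ?A) \<theta> = 0"
    using eigenvalue_root_char_poly[OF A] unfolding eigenvalue_def by blast
  then show ?thesis
    by (simp add: to_ac.char_poly_hom[of _ n] char_poly_transpose_mat[of _ n])
qed

lemma not_root_char_poly:
  assumes "\<theta> \<in> F" "poly (char_poly (mmat \<theta>)) t \<noteq> 0"
  shows "to_ac t \<noteq> \<theta>"
proof
  assume "to_ac t = \<theta>"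
  then have "to_ac (poly (char_poly (mmat \<theta>)) t) = 0"
    using ac_poly_char_poly_root[OF assms(1)] by (simp flip: to_ac.poly_map_poly)
  then show False using assms(2) by simp
qed

text \<open>Reduction modulo \<open>p\<close> shows that the powers of \<theta> below
  \<open>degree p\<close> span K(\<theta>).\<close>

lemma degree_ge:
  assumes \<theta>: "adjoin \<theta> = F" and p: "p \<noteq> 0" "poly (map_poly to_ac p) \<theta> = 0"
  shows "n \<le> degree p"
proof -
  let ?S = "(\<lambda>i. \<theta> ^ i) ` {..<degree p}"
  have "F \<subseteq> ac.span ?S"
  proof
    fix x assume "x \<in> F"
    then obtain q where q: "x = poly (map_poly to_ac q) \<theta>"
      using \<theta> by (auto simp: adjoin_def)
    define r where "r = q mod p"
    have "x = poly (map_poly to_ac (q div p * p + r)) \<theta>"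
      by (simp add: q r_def)
    then have x: "x = poly (map_poly to_ac r) \<theta>"
      using p(2) by (simp add: map_to_ac.hom_add map_to_ac.hom_mult)
    have "r = 0 \<or> degree r < degree p"
      unfolding r_def using degree_mod_less[OF p(1)] .
    then show "x \<in> ac.span ?S"
    proof
      assume "r = 0"
      then show ?thesis using x ac.span_zero by simp
    next
      assume r: "degree r < degree p"
      have "x = (\<Sum>i\<le>degree r. ac_scale (coeff r i) (\<theta> ^ i))"
        by (simp add: x poly_altdef ac_scale_def)
      also have "\<dots> \<in> ac.span ?S"
        by (intro ac.span_sum ac.span_scale ac.span_base) (use r in auto)
      finally show ?thesis .
    qed
  qed
  then have "n \<le> card ?S"
    by (rule ac.dim_le_card) simp
  then show ?thesis
    using card_image_le[of "{..<degree p}" "\<lambda>i. \<theta> ^ i"] by simp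
qed

text \<open>By \<open>degree_ge\<close> no nonzero polynomial of degree below \<open>n\<close> kills
  \<theta>, so the characteristic polynomial divides a separable \<open>f\<close> vanishing at
  \<theta>, and a simple root of \<open>f\<close> is a simple root of the divisor.\<close>

lemma char_poly_simple_root:
  assumes \<theta>: "adjoin \<theta> = F"
  shows "poly (pderiv (map_poly to_ac (char_poly (mmat \<theta>)))) \<theta> \<noteq> 0"
proof -
  have "\<theta> \<in> F" using \<theta> self_in_adjoin by blast
  define \<chi> where "\<chi> = char_poly (mmat \<theta>)"
  have \<chi>: "degree \<chi> = n" "\<chi> \<noteq> 0" "poly (map_poly to_ac \<chi>) \<theta> = 0"
    using degree_monic_char_poly[OF mmat_carrier, of \<theta>] ac_poly_char_poly_root[OF \<open>\<theta> \<in> F\<close>]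
    by (auto simp: \<chi>_def)
  have "separable_element \<theta>"
    using \<open>\<theta> \<in> F\<close> F unfolding finite_separable_extension_def by blast
  then obtain f where f: "poly (map_poly to_ac f) \<theta> = 0" "rsquarefree (map_poly to_ac f)"
    unfolding separable_element_def separable_poly_def by blast
  have "f mod \<chi> = 0"
  proof (rule ccontr)
    assume r0: "f mod \<chi> \<noteq> 0"
    have "poly (map_poly to_ac (f div \<chi> * \<chi> + f mod \<chi>)) \<theta> = 0"
      using f(1) by simp
    then have "poly (map_poly to_ac (f mod \<chi>)) \<theta> = 0"
      using \<chi>(3) by (simp only: map_to_ac.hom_add map_to_ac.hom_mult poly_add poly_mult) simp
    then have "n \<le> degree (f mod \<chi>)"
      using degree_ge[OF \<theta> r0] by blast
    moreover have "degree (f mod \<chi>) < n"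
      using degree_mod_less[OF \<chi>(2), of f] r0 \<chi>(1) by simp
    ultimately show False by simp
  qed
  then obtain k where "f = \<chi> * k"
    by (metis mod_0_imp_dvd dvdE)
  then have "map_poly to_ac f = map_poly to_ac \<chi> * map_poly to_ac k"
    by (simp add: map_to_ac.hom_mult)
  moreover have "poly (pderiv (map_poly to_ac f)) \<theta> \<noteq> 0"
    using simple_root_pderiv f by blast
  ultimately show ?thesis
    using \<chi>(3) by (auto simp: pderiv_mult \<chi>_def)
qed

text \<open>By separability neither \<chi> nor its derivative is the zero polynomial, so some t in
  the infinite field K is a root of neither. \<open>tr_inverse\<close> then gives 1/(t - \<theta>) a
  nonzero trace.\<close>

lemma ex_tr_nonzero: "\<exists>x\<in>F. tr x \<noteq> 0"
proof -
  obtain \<theta> where \<theta>: "\<theta> \<in> F" "adjoin \<theta> = F"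
    using ex_primitive_element by blast
  define \<chi> where "\<chi> = char_poly (mmat \<theta>)"
  have "\<chi> \<noteq> 0"
    using degree_monic_char_poly[OF mmat_carrier, of \<theta>] by (auto simp: \<chi>_def)
  moreover have "pderiv \<chi> \<noteq> 0"
  proof
    assume d: "pderiv \<chi> = 0"
    have "pderiv (map_poly to_ac \<chi>) = map_poly to_ac (pderiv \<chi>)"
      by (simp add: to_ac.map_poly_pderiv)
    then show False
      using char_poly_simple_root[OF \<theta>(2)] d by (simp add: \<chi>_def)
  qed
  ultimately have "\<chi> * pderiv \<chi> \<noteq> 0" by simp
  then have "finite {t. poly (\<chi> * pderiv \<chi>) t = 0}"
    by (rule poly_roots_finite)
  then obtain t where t: "poly (\<chi> * pderiv \<chi>) t \<noteq> 0"
    using ex_new_if_finite[OF infinite_base] by blast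
  then have "to_ac t \<noteq> \<theta>"
    using not_root_char_poly[OF \<theta>(1)] by (auto simp: \<chi>_def)
  then have "tr (inverse (to_ac t - \<theta>)) \<noteq> 0"
    using tr_inverse[OF \<theta>(1), of t] t by (auto simp: \<chi>_def)
  then show ?thesis
    using \<theta>(1) by (auto intro!: inverse diff)
qed

section \<open>Gram matrices and discriminants of scaled trace forms\<close>

lemma tr_0 [simp]: "tr 0 = 0"
  by (simp add: tr_eq)

lemma tr_sum: "(\<And>k. k \<in> I \<Longrightarrow> f k \<in> F) \<Longrightarrow> tr (\<Sum>k\<in>I. f k) = (\<Sum>k\<in>I. tr (f k))"
  by (induction I rule: infinite_finite_induct) (simp_all add: tr_add sum)

lemma tr_mult_expand:
  assumes "x \<in> F" "y \<in> F"
  shows "tr (x * y) = (\<Sum>k<n. crd x k * tr (bs k * y))"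
proof -
  have "x * y = (\<Sum>k<n. to_ac (crd x k) * (bs k * y))"
    by (subst crd_expand[OF assms(1)]) (simp add: sum_distrib_right mult.assoc)
  also have "tr \<dots> = (\<Sum>k<n. tr (to_ac (crd x k) * (bs k * y)))"
    using assms by (intro tr_sum mult) auto
  also have "\<dots> = (\<Sum>k<n. crd x k * tr (bs k * y))"
    using assms by (intro sum.cong refl tr_scale mult) auto
  finally show ?thesis .
qed

definition crd_mat :: "(nat \<Rightarrow> 'a alg_closure) \<Rightarrow> 'a mat" where
  "crd_mat e = mat n n (\<lambda>(i, j). crd (e j) i)"

definition trace_gram :: "'a mat" where
  "trace_gram = mat n n (\<lambda>(i, j). tr (bs i * bs j))"

lemma crd_mat_carrier [simp]: "crd_mat e \<in> carrier_mat n n"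
  by (simp add: crd_mat_def)

lemma trace_gram_carrier [simp]: "trace_gram \<in> carrier_mat n n"
  by (simp add: trace_gram_def)

text \<open>Two separate families are allowed so that the factor \<alpha> can be put on one side
  only.\<close>

lemma gram_eq:
  assumes u: "\<And>i. i < n \<Longrightarrow> u i \<in> F" and v: "\<And>i. i < n \<Longrightarrow> v i \<in> F"
  shows "mat n n (\<lambda>(i, j). tr (u i * v j)) = (crd_mat u)\<^sup>T * (trace_gram * crd_mat v)"
proof (rule eq_matI)
  fix i j assume "i < dim_row ((crd_mat u)\<^sup>T * (trace_gram * crd_mat v))"
    "j < dim_col ((crd_mat u)\<^sup>T * (trace_gram * crd_mat v))"
  then have ij: "i < n" "j < n" by (simp_all add: crd_mat_def)
  have inner: "(trace_gram * crd_mat v) $$ (k, j) = tr (bs k * v j)" if "k < n" for k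
    using that ij v tr_mult_expand[of "v j" "bs k"]
    by (simp add: trace_gram_def crd_mat_def scalar_prod_def atLeast0LessThan mult.commute)
  have "((crd_mat u)\<^sup>T * (trace_gram * crd_mat v)) $$ (i, j) =
      (\<Sum>k<n. crd (u i) k * (trace_gram * crd_mat v) $$ (k, j))"
    using ij by (simp add: scalar_prod_def atLeast0LessThan crd_mat_def trace_gram_def)
  also have "\<dots> = tr (u i * v j)"
    using inner ij u v by (simp add: tr_mult_expand[of "u i"])
  finally show "mat n n (\<lambda>(i, j). tr (u i * v j)) $$ (i, j) =
      ((crd_mat u)\<^sup>T * (trace_gram * crd_mat v)) $$ (i, j)"
    using ij by simp
qed (simp_all add: crd_mat_def)

lemma crd_mat_mult:
  assumes "\<alpha> \<in> F" "\<And>i. i < n \<Longrightarrow> e i \<in> F"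
  shows "crd_mat (\<lambda>j. \<alpha> * e j) = mmat \<alpha> * crd_mat e"
proof (rule eq_matI)
  fix i j assume "i < dim_row (mmat \<alpha> * crd_mat e)" "j < dim_col (mmat \<alpha> * crd_mat e)"
  then have ij: "i < n" "j < n" by (simp_all add: crd_mat_def mmat_def)
  then show "crd_mat (\<lambda>j. \<alpha> * e j) $$ (i, j) = (mmat \<alpha> * crd_mat e) $$ (i, j)"
    using assms crd_mult_expand[of \<alpha> "e j" i]
    by (simp add: crd_mat_def mmat_def scalar_prod_def atLeast0LessThan mult.commute)
qed (simp_all add: crd_mat_def mmat_def)

text \<open>The discriminant of the form scaled by \<open>\<alpha>\<close> changes by the norm of \<open>\<alpha>\<close>.\<close>

lemma prod_orthogonal_trace:
  assumes "\<alpha> \<in> F" and e: "\<And>i. i < n \<Longrightarrow> e i \<in> F"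
    and orth: "\<And>i j. i < n \<Longrightarrow> j < n \<Longrightarrow> i \<noteq> j \<Longrightarrow> tr (\<alpha> * e i * e j) = 0"
  shows "(\<Prod>i<n. tr (\<alpha> * e i * e i)) = det (mmat \<alpha>) * (det (crd_mat e))\<^sup>2 * det trace_gram"
proof -
  \<comment> \<open>Orthogonality makes this Gram matrix diagonal, so its determinant is the product
    of the values; absorbing \<alpha> into the left family yields the other factorization.\<close>
  define D where "D = mat n n (\<lambda>(i, j). tr (\<alpha> * e i * e j))"
  have D: "D \<in> carrier_mat n n" by (simp add: D_def)
  have "upper_triangular D"
    using orth by (auto simp: D_def upper_triangular_def)
  then have "det D = prod_list (diag_mat D)"
    using det_upper_triangular D by blast
  then have "det D = (\<Prod>i<n. tr (\<alpha> * e i * e i))"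
    by (simp add: prod_list_diag_prod D_def atLeast0LessThan)
  moreover have "D = (mmat \<alpha> * crd_mat e)\<^sup>T * (trace_gram * crd_mat e)"
    unfolding D_def using assms by (simp add: gram_eq mult flip: crd_mat_mult)
  moreover have P: "mmat \<alpha> * crd_mat e \<in> carrier_mat n n" "trace_gram * crd_mat e \<in> carrier_mat n n"
    by (simp_all add: mult_carrier_mat[of _ n n])
  ultimately show ?thesis
    using det_mult[OF transpose_carrier_mat[THEN iffD2, OF P(1)] P(2)] det_transpose[OF P(1)]
      det_mult[of "mmat \<alpha>" n "crd_mat e"] det_mult[of trace_gram n "crd_mat e"]
    by (simp add: power2_eq_square mult_ac)
qed

text \<open>Non-degeneracy: for u nonzero and z of nonzero trace, u pairs with z / (\<alpha> u) to
  Tr(z).\<close>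

lemma sym_form_trace:
  assumes "(2::'a) \<noteq> 0" "\<alpha> \<in> F" "\<alpha> \<noteq> 0"
  shows "sym_form ac_scale F B n (\<lambda>x y. tr (\<alpha> * x * y))"
proof
  show "finite B" "ac.independent B" "ac.span B = F" "card B = n"
    by (fact basis_B)+
  show "tr (\<alpha> * (u + u') * v) = tr (\<alpha> * u * v) + tr (\<alpha> * u' * v)"
    if "u \<in> F" "u' \<in> F" "v \<in> F" for u u' v
    using that assms by (simp add: distrib_left distrib_right tr_add mult)
  show "tr (\<alpha> * ac_scale c u * v) = c * tr (\<alpha> * u * v)" if "u \<in> F" "v \<in> F" for c u v
    using that assms tr_scale[of "\<alpha> * u * v" c] by (simp add: ac_scale_def mult mult_ac)
  show "tr (\<alpha> * u * v) = tr (\<alpha> * v * u)" for u v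
    by (simp add: mult_ac)
  show "u = 0" if u: "u \<in> F" "\<And>v. v \<in> F \<Longrightarrow> tr (\<alpha> * u * v) = 0" for u
  proof (rule ccontr)
    assume "u \<noteq> 0"
    obtain z where z: "z \<in> F" "tr z \<noteq> 0" using ex_tr_nonzero by blast
    have "z / (\<alpha> * u) \<in> F"
      using z u assms by (intro divide mult)
    then have "tr (\<alpha> * u * (z / (\<alpha> * u))) = 0" by (rule u(2))
    then show False using z \<open>u \<noteq> 0\<close> assms by simp
  qed
qed (fact assms(1))

text \<open>For \<alpha> = 1 the product of the nonzero values on an orthogonal basis contains this
  determinant as a factor.\<close>

lemma det_trace_gram_nonzero:
  assumes "(2::'a) \<noteq> 0"
  shows "det trace_gram \<noteq> 0"
proof -
  interpret T: sym_form ac_scale F B n "\<lambda>x y. tr (1 * x * y)"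
    using assms one by (intro sym_form_trace) simp_all
  obtain e where e: "T.orthogonal_basis e" using T.ex_orthogonal_basis by blast
  have "(\<Prod>i<n. tr (1 * e i * e i)) \<noteq> 0"
    using T.orthogonal_basisD(2)[OF e] by simp
  then show ?thesis
    using prod_orthogonal_trace[of 1 e] one T.orthogonal_basisD[OF e] by auto
qed

text \<open>A point (t, y) with y nonzero on c Y^2 = \<chi>(X) gives \<alpha> = t - \<theta> of norm
  c y^2.\<close>

lemma ex_norm_eq_mod_squares:
  assumes PAC: "PAC TYPE('a)" and c: "c \<noteq> 0"
  shows "\<exists>\<alpha>\<in>F. \<alpha> \<noteq> 0 \<and> (\<exists>y. y \<noteq> 0 \<and> det (mmat \<alpha>) = c * y\<^sup>2)"
proof -
  obtain \<theta> where \<theta>: "\<theta> \<in> F" "adjoin \<theta> = F"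
    using ex_primitive_element by blast
  define \<chi> where "\<chi> = char_poly (mmat \<theta>)"
  have "\<chi> \<noteq> 0"
    using degree_monic_char_poly[OF mmat_carrier, of \<theta>] by (auto simp: \<chi>_def)
  \<comment> \<open>Points with y = 0 lie over the finitely many roots of \<chi>, so infinitely many
    points leave one with y nonzero.\<close>
  then have "finite ({x. poly \<chi> x = 0} \<times> {0})"
    by (simp add: poly_roots_finite)
  moreover have "infinite {(x, y). c * y\<^sup>2 = poly \<chi> x}"
    using PAC_infinite_square_curve[OF PAC c ac_poly_char_poly_root char_poly_simple_root] \<theta>
    by (simp add: \<chi>_def)
  ultimately have "\<not> {(x, y). c * y\<^sup>2 = poly \<chi> x} \<subseteq> {x. poly \<chi> x = 0} \<times> {0}"
    using finite_subset by blast
  then obtain t y where t: "c * y\<^sup>2 = poly \<chi> t" "\<not> (poly \<chi> t = 0 \<and> y = 0)"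
    by blast
  then have ty: "c * y\<^sup>2 = poly \<chi> t" "y \<noteq> 0"
    by auto
  have "poly \<chi> t \<noteq> 0"
    using ty c by (simp flip: ty(1))
  then have "to_ac t - \<theta> \<noteq> 0"
    using not_root_char_poly[OF \<theta>(1), of t] by (simp add: \<chi>_def)
  moreover have "det (mmat (to_ac t - \<theta>)) = c * y\<^sup>2"
    using poly_char_poly_mmat[OF \<theta>(1)] ty by (simp add: \<chi>_def)
  moreover have "to_ac t - \<theta> \<in> F"
    using \<theta>(1) by (simp add: diff)
  ultimately show ?thesis using ty(2) by blast
qed

end


section \<open>Quadratic forms over PAC fields\<close>

lemma quadratic_form_eq_polar:
  assumes "quadratic_form scale q"
  shows "polar q v v = 2 * q v"
proof -
  interpret vector_space scale
    using assms by (simp add: quadratic_form_def)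
  have "scale 2 v = v + v"
    using scale_left_distrib[of 1 1 v] by simp
  moreover have "q (scale 2 v) = 2\<^sup>2 * q v"
    using assms unfolding quadratic_form_def by blast
  ultimately show ?thesis
    by (simp add: polar_def)
qed

text \<open>Halving the polar form gives the symmetric bilinear form whose diagonal is
  \<open>q\<close>.\<close>

lemma sym_form_polar:
  fixes scale :: "'a::field \<Rightarrow> 'v::ab_group_add \<Rightarrow> 'v"
  assumes q: "quadratic_form scale q" and "nondegenerate q" and two: "(2::'a) \<noteq> 0"
    and C: "finite C" "\<not> module.dependent scale C" "module.span scale C = UNIV" "card C = n"
  shows "sym_form scale UNIV C n (\<lambda>u v. polar q u v / 2)"
proof -
  interpret vector_space scale
    using q by (simp add: quadratic_form_def)
  have l: "Vector_Spaces.linear scale (*) (\<lambda>u. polar q u v)" for v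
    using q unfolding quadratic_form_def by blast
  show ?thesis
  proof
    show "polar q (u + u') v / 2 = polar q u v / 2 + polar q u' v / 2" for u u' v
      using l[of v] by (simp add: Vector_Spaces.linear_iff add_divide_distrib)
    show "polar q (scale c u) v / 2 = c * (polar q u v / 2)" for c u v
      using l[of v] by (simp add: Vector_Spaces.linear_iff)
    show "polar q u v / 2 = polar q v u / 2" for u v
      by (simp add: polar_def add.commute)
    show "u = 0" if "\<And>v. v \<in> UNIV \<Longrightarrow> polar q u v / 2 = 0" for u
      using that assms(2) two by (simp add: nondegenerate_def)
  qed (use C two in simp_all)
qed

theorem theorem3:
  fixes scale :: "'a::field \<Rightarrow> 'v::ab_group_add \<Rightarrow> 'v"
    and q :: "'v \<Rightarrow> 'a"
    and n :: nat
  assumes "PAC TYPE('a)"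
    and "CHAR('a) \<noteq> 2"
    and "n \<ge> 1"
    and "quadratic_form scale q"
    and "nondegenerate q"
    and "vector_space.dim scale (UNIV :: 'v set) = n"
  shows "isomorphic_to_scaled_trace_form scale q \<longleftrightarrow>
         (\<exists>F :: 'a alg_closure set. finite_separable_extension F \<and> ext_degree F = n)"
proof -
  interpret V: vector_space scale
    using assms(4) by (simp add: quadratic_form_def)
  have two: "(2::'a) \<noteq> 0"
  proof
    assume "(2::'a) = 0"
    then have "of_nat 2 = (0::'a)" by simp
    then have "CHAR('a) dvd 2" by (simp only: of_nat_eq_0_iff_char_dvd)
    then have "CHAR('a) \<le> 2" "CHAR('a) \<noteq> 0"
      by (auto dest: dvd_imp_le intro: Nat.gr0I)
    moreover have "CHAR('a) \<noteq> 1" by simp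
    ultimately show False using assms(2) by linarith
  qed
  obtain C where C: "C \<subseteq> UNIV" "V.independent C" "UNIV \<subseteq> V.span C" "card C = V.dim UNIV"
    using V.basis_exists .
  \<comment> \<open>An infinite set has \<open>card\<close> 0, so n \<ge> 1 is what makes the basis
    finite.\<close>
  then have C_span: "V.span C = UNIV" and C_card: "card C = n" and C_fin: "finite C"
    using assms(3,6) by (auto intro: card_ge_0_finite)
  show ?thesis
  proof
    assume "isomorphic_to_scaled_trace_form scale q"
    then obtain F \<phi> where F: "finite_separable_extension F"
      and \<phi>: "Vector_Spaces.linear scale ac_scale \<phi>" "bij_betw \<phi> UNIV F"
      unfolding isomorphic_to_scaled_trace_form_def by blast
    interpret pair: vector_space_pair scale ac_scale ..
    \<comment> \<open>The isomorphism carries the basis \<open>C\<close> to a basis of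
      \<open>F\<close>, so the degree is \<open>n\<close>.\<close>
    have inj: "inj \<phi>" and surj: "\<phi> ` UNIV = F"
      using \<phi>(2) by (auto simp: bij_betw_def)
    have "ac.independent (\<phi> ` C)"
      using pair.linear_independent_injective_image[OF \<phi>(1) C(2)] inj by (auto intro: inj_on_subset)
    moreover have "ac.span (\<phi> ` C) = F"
      using pair.linear_span_image[OF \<phi>(1), of C] C_span surj by simp
    ultimately have "ext_degree F = card (\<phi> ` C)"
      using ac.dim_span_eq_card_independent by metis
    also have "\<dots> = n"
      using inj C_card by (simp add: card_image inj_on_subset)
    finally show "\<exists>F :: 'a alg_closure set. finite_separable_extension F \<and> ext_degree F = n"
      using F by blast
  next
    assume "\<exists>F :: 'a alg_closure set. finite_separable_extension F \<and> ext_degree F = n"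
    then obtain F :: "'a alg_closure set" where F: "finite_separable_extension F" and deg: "ext_degree F = n"
      by blast
    interpret E: finite_sep_ext F
      using F PAC_infinite[OF assms(1)] by unfold_locales
    \<comment> \<open>\<open>k\<close> is the index of the last basis vector, the only one whose
      value is not normalized to 1.\<close>
    obtain k where k: "n = Suc k"
      using assms(3) by (cases n) auto
    note binary = PAC_binary_form[OF assms(1) two]
    interpret Q: sym_form scale UNIV C n "\<lambda>u v. polar q u v / 2"
      using sym_form_polar[OF assms(4,5) two C_fin C(2) C_span C_card] .
    obtain e where e: "Q.orthogonal_basis e"
      and e1: "\<And>i. Suc i < n \<Longrightarrow> polar q (e i) (e i) / 2 = 1"
      using Q.ex_almost_orthonormal_basis[OF binary] by blast
    define d where "d = polar q (e k) (e k) / 2"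
    have "d \<noteq> 0"
      using Q.orthogonal_basisD(2)[OF e, of k] k by (simp add: d_def)
    define D where "D = det E.trace_gram"
    have "D \<noteq> 0"
      using E.det_trace_gram_nonzero[OF two] by (simp add: D_def)
    \<comment> \<open>With this norm the form Tr(\<alpha> x^2) has discriminant d up to squares,
      since \<open>D\<close> is that of Tr(x^2).\<close>
    then obtain \<alpha> y where \<alpha>: "\<alpha> \<in> F" "\<alpha> \<noteq> 0" and y: "y \<noteq> 0" "det (E.mmat \<alpha>) = d / D * y\<^sup>2"
      using E.ex_norm_eq_mod_squares[OF assms(1), of "d / D"] \<open>d \<noteq> 0\<close> by auto
    interpret T: sym_form ac_scale F E.B n "\<lambda>x y. E.tr (\<alpha> * x * y)"
      using E.sym_form_trace[OF two \<alpha>] deg by simp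
    obtain f where f: "T.orthogonal_basis f"
      and f1: "\<And>i. Suc i < n \<Longrightarrow> E.tr (\<alpha> * f i * f i) = 1"
      using T.ex_almost_orthonormal_basis[OF binary] by blast
    define p where "p = det (E.crd_mat f)"
    \<comment> \<open>All factors but the last are 1, so the last value is the whole
      discriminant.\<close>
    have "(\<Prod>i<n. E.tr (\<alpha> * f i * f i)) = E.tr (\<alpha> * f k * f k)"
      using f1 by (simp add: k)
    then have disc: "E.tr (\<alpha> * f k * f k) = d * (y * p)\<^sup>2"
      using E.prod_orthogonal_trace[OF \<alpha>(1), of f] T.orthogonal_basisD[OF f] y(2) \<open>D \<noteq> 0\<close>
      by (simp add: deg p_def D_def power_mult_distrib)
    moreover have "E.tr (\<alpha> * f k * f k) \<noteq> 0"
      using T.orthogonal_basisD(2)[OF f, of k] k by simp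
    ultimately have yp: "y * p \<noteq> 0" by auto
    \<comment> \<open>Rescaling the last vector by 1/(y p) turns its value d (y p)^2 into exactly d,
      and then all diagonal values agree with those of \<open>q\<close>.\<close>
    define s where "s = inverse (y * p)"
    define g where "g = f(k := ac_scale s (f k))"
    have g: "T.orthogonal_basis g"
      unfolding g_def using yp by (intro T.orthogonal_basis_rescale[OF f]) (simp add: s_def)
    have "polar q (e i) (e i) / 2 = E.tr (\<alpha> * g i * g i)" if "i < n" for i
    proof (cases "i = k")
      case True
      have fk: "f k \<in> F" using T.orthogonal_basisD(1)[OF f, of k] k by simp
      have "E.tr (\<alpha> * g k * g k) = s * (s * E.tr (\<alpha> * f k * f k))"
        using fk T.scale_left[of "f k" "ac_scale s (f k)" s] T.scale_right[of "f k" "f k" s]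
        by (simp add: g_def)
      also have "\<dots> = d * (s * (y * p))\<^sup>2"
        unfolding disc by (simp only: power2_eq_square mult_ac)
      also have "s * (y * p) = 1"
        unfolding s_def using yp by (rule Fields.left_inverse)
      finally have "E.tr (\<alpha> * g k * g k) = d"
        by simp
      then show ?thesis using True by (simp add: d_def)
    next
      case False
      then show ?thesis using that e1[of i] f1[of i] k by (simp add: g_def)
    qed
    then obtain \<phi> where \<phi>: "Vector_Spaces.linear scale ac_scale \<phi>" "bij_betw \<phi> UNIV F"
      and eq: "\<And>v. polar q v v / 2 = E.tr (\<alpha> * \<phi> v * \<phi> v)"
      using isometry_of_orthogonal_bases[OF Q.sym_form_axioms T.sym_form_axioms e g] by blast
    have "q v = scaled_trace_form F \<alpha> (\<phi> v)" for v
      using eq[of v] two quadratic_form_eq_polar[OF assms(4), of v]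
      by (simp add: scaled_trace_form_def E.tr_def power2_eq_square mult.assoc)
    then show "isomorphic_to_scaled_trace_form scale q"
      unfolding isomorphic_to_scaled_trace_form_def using F \<alpha> \<phi> by blast
  qed
qed

end
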